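(* Let $\alpha: G \to \mathrm{Aut}(A)$ be an action of a discrete group $G$ on a unital $C^*$-algebra $A$, and assume that $G$ is countable. Then $\alpha$ has the Haagerup property if and only if there exists a spectrally proper $Z(A)^+$-valued normalized $\alpha$-negative definite function on $G$.
   Context: $Z(A)$ is the center of $A$, $A^+$ its positive cone, $Z(A)^+ = Z(A)\cap A^+$, $1_A$ the unit of $A$, $e$ the identity of $G$. $C_0(G,A)$ is the space of functions $f: G\to A$ such that for every $\epsilon>0$ there is a finite subset $F\subset G$ with $\|f(g)\|<\epsilon$ for all $g\notin F$. A function $\varphi: G\to A$ is $\alpha$-positive definite if for any $n\in\mathbb{N}$ and $g_1,\dots,g_n\in G$ the matrix $\big[\alpha_{g_i}(\varphi(g_i^{-1}g_j))\big]$ is positive in $M_n(A)$. A function $\psi: G\to A$ is $\alpha$-negative definite if $\alpha_g(\psi(g^{-1})) = \psi(g)^*$ for all $g\in G$ and, for any $n\in\mathbb{N}$, $g_1,\dots,g_n\in G$ and $b_1,\dots,b_n\in A$ with $\sum_{i=1}^n b_i = 0$, one has $\sum_{i,j=1}^n b_i^*\,\alpha_{g_i}\big(\psi(g_i^{-1}g_j)\big)\,b_j \leq 0$ in $A$. It is normalized if $\psi(e)=0$. The action $\alpha$ of the countable group $G$ has the Haagerup property if there exists a sequence $(h_n)$ of $\alpha$-positive definite $Z(A)$-valued functions on $G$ such that $h_n(e)=1_A$ and $h_n\in C_0(G,A)$ for all $n\in\mathbb{N}$, and $\|h_n(g)-1_A\|\to 0$ as $n\to\infty$ for all $g\in G$.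 A function $\psi: G\to A^+$ is spectrally proper if the function $\ell_\psi: G\to\mathbb{R}^+=[0,\infty)$, $\ell_\psi(g) = \inf \mathrm{sp}(\psi(g))$ (where $\mathrm{sp}$ denotes the spectrum in $A$) is proper, i.e. $\{g\in G \mid \ell_\psi(g)\leq R\}$ is finite for every $R\geq 0$. *)

theory Defs
  imports
    Complex_Main
    "HOL-Algebra.Group"
    "HOL-Library.Countable_Set"
    "HOL-Library.FuncSet"
    "HOL-Library.Nonpos_Ints"
    "Jordan_Normal_Form.Matrix"
begin

(* As always for real_normed_algebra_1, the unit has norm 1, so the zero algebra is excluded. *)
class unital_cstar_algebra = real_normed_algebra_1 + banach +
  fixes scaleC :: "complex \<Rightarrow> 'a \<Rightarrow> 'a"  (infixr \<open>*\<^sub>C\<close> 75)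
    and star :: "'a \<Rightarrow> 'a"
  assumes scaleR_eq_scaleC: "r *\<^sub>R x = complex_of_real r *\<^sub>C x"
    and scaleC_add_right: "c *\<^sub>C (x + y) = c *\<^sub>C x + c *\<^sub>C y"
    and scaleC_add_left: "(c + d) *\<^sub>C x = c *\<^sub>C x + d *\<^sub>C x"
    and scaleC_scaleC: "c *\<^sub>C (d *\<^sub>C x) = (c * d) *\<^sub>C x"
    and norm_scaleC: "norm (c *\<^sub>C x) = cmod c * norm x"
    and mult_scaleC_left: "(c *\<^sub>C x) * y = c *\<^sub>C (x * y)"
    and mult_scaleC_right: "x * (c *\<^sub>C y) = c *\<^sub>C (x * y)"
    and star_star: "star (star x) = x"
    and star_add: "star (x + y) = star x + star y"
    and star_scaleC: "star (c *\<^sub>C x) = cnj c *\<^sub>C star x"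
    and star_mult: "star (x * y) = star y * star x"
    and norm_star_mult_self: "norm (star x * x) = (norm x)\<^sup>2"

definition alg_spectrum :: "'a::unital_cstar_algebra \<Rightarrow> complex set" where
  "alg_spectrum a =
     {z. \<not> (\<exists>b. (z *\<^sub>C 1 - a) * b = 1 \<and> b * (z *\<^sub>C 1 - a) = 1)}"

definition positive_cone :: "'a::unital_cstar_algebra set" where
  "positive_cone = {a. star a = a \<and> alg_spectrum a \<subseteq> \<real>\<^sub>\<ge>\<^sub>0}"

definition cstar_le :: "'a::unital_cstar_algebra \<Rightarrow> 'a \<Rightarrow> bool"  (infix \<open>\<le>\<^sub>A\<close> 50) where
  "a \<le>\<^sub>A b \<longleftrightarrow> b - a \<in> positive_cone"

definition algebra_center :: "'a::unital_cstar_algebra set" where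
  "algebra_center = {z. \<forall>a. z * a = a * z}"

definition center_positive :: "'a::unital_cstar_algebra set" where
  "center_positive = algebra_center \<inter> positive_cone"

(* The algebra M_n(A) is carrier_mat n n. Neither its spectrum nor its involution involves
   the norm, so positivity in this C*-algebra is expressible without constructing it. *)

definition mat_star :: "'a::unital_cstar_algebra mat \<Rightarrow> 'a mat" where
  "mat_star M = transpose_mat (map_mat star M)"

definition mat_spectrum :: "'a::unital_cstar_algebra mat \<Rightarrow> complex set" where
  "mat_spectrum M =
     {z. \<not> invertible_mat ((z *\<^sub>C 1) \<cdot>\<^sub>m 1\<^sub>m (dim_row M) - M)}"

definition mat_positive :: "nat \<Rightarrow> 'a::unital_cstar_algebra mat \<Rightarrow> bool" where
  "mat_positive n M \<longleftrightarrow>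
     M \<in> carrier_mat n n \<and> mat_star M = M \<and> mat_spectrum M \<subseteq> \<real>\<^sub>\<ge>\<^sub>0"

definition star_automorphism :: "('a::unital_cstar_algebra \<Rightarrow> 'a) \<Rightarrow> bool" where
  "star_automorphism f \<longleftrightarrow>
     bij f \<and>
     (\<forall>x y. f (x + y) = f x + f y) \<and>
     (\<forall>c x. f (c *\<^sub>C x) = c *\<^sub>C f x) \<and>
     (\<forall>x y. f (x * y) = f x * f y) \<and>
     (\<forall>x. f (star x) = star (f x))"

definition Aut :: "('a::unital_cstar_algebra \<Rightarrow> 'a) monoid" where
  "Aut = \<lparr>carrier = Collect star_automorphism, mult = (\<circ>), one = id\<rparr>"

(* A function on the group is a HOL function of which only the values on the carrier matter. *)

definition C0 :: "('g, 'm) monoid_scheme \<Rightarrow> ('g \<Rightarrow> 'a::unital_cstar_algebra) set" where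
  "C0 G = {f. \<forall>\<epsilon>>0. \<exists>F. finite F \<and> F \<subseteq> carrier G \<and> (\<forall>g\<in>carrier G - F. norm (f g) < \<epsilon>)}"

definition positive_definite ::
  "('g, 'm) monoid_scheme \<Rightarrow> ('g \<Rightarrow> 'a \<Rightarrow> 'a) \<Rightarrow> ('g \<Rightarrow> 'a::unital_cstar_algebra) \<Rightarrow> bool" where
  "positive_definite G \<alpha> \<phi> \<longleftrightarrow>
     (\<forall>n. \<forall>g :: nat \<Rightarrow> 'g. (\<forall>i<n. g i \<in> carrier G) \<longrightarrow>
        mat_positive n (mat n n (\<lambda>(i, j). \<alpha> (g i) (\<phi> (inv\<^bsub>G\<^esub> (g i) \<otimes>\<^bsub>G\<^esub> g j)))))"

definition negative_definite ::
  "('g, 'm) monoid_scheme \<Rightarrow> ('g \<Rightarrow> 'a \<Rightarrow> 'a) \<Rightarrow> ('g \<Rightarrow> 'a::unital_cstar_algebra) \<Rightarrow> bool" where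
  "negative_definite G \<alpha> \<psi> \<longleftrightarrow>
     (\<forall>g\<in>carrier G. \<alpha> g (\<psi> (inv\<^bsub>G\<^esub> g)) = star (\<psi> g)) \<and>
     (\<forall>n. \<forall>g :: nat \<Rightarrow> 'g. \<forall>b :: nat \<Rightarrow> 'a.
        (\<forall>i<n. g i \<in> carrier G) \<longrightarrow> (\<Sum>i<n. b i) = 0 \<longrightarrow>
        (\<Sum>i<n. \<Sum>j<n. star (b i) * \<alpha> (g i) (\<psi> (inv\<^bsub>G\<^esub> (g i) \<otimes>\<^bsub>G\<^esub> g j)) * b j) \<le>\<^sub>A 0)"

definition normalized ::
  "('g, 'm) monoid_scheme \<Rightarrow> ('g \<Rightarrow> 'a::unital_cstar_algebra) \<Rightarrow> bool" where
  "normalized G \<psi> \<longleftrightarrow> \<psi> \<one>\<^bsub>G\<^esub> = 0"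

definition haagerup_property ::
  "('g, 'm) monoid_scheme \<Rightarrow> ('g \<Rightarrow> 'a::unital_cstar_algebra \<Rightarrow> 'a) \<Rightarrow> bool" where
  "haagerup_property G \<alpha> \<longleftrightarrow>
     (\<exists>h :: nat \<Rightarrow> 'g \<Rightarrow> 'a.
        (\<forall>n. positive_definite G \<alpha> (h n) \<and>
             h n \<in> carrier G \<rightarrow> algebra_center \<and>
             h n \<one>\<^bsub>G\<^esub> = 1 \<and>
             h n \<in> C0 G) \<and>
        (\<forall>g\<in>carrier G. (\<lambda>n. norm (h n g - 1)) \<longlonglongrightarrow> 0))"

(* The infimum of the spectrum, which for positive elements consists of nonnegative reals. *)
definition spectral_length :: "('g \<Rightarrow> 'a::unital_cstar_algebra) \<Rightarrow> 'g \<Rightarrow> real" where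
  "spectral_length \<psi> g = Inf {r :: real. complex_of_real r \<in> alg_spectrum (\<psi> g)}"

definition spectrally_proper ::
  "('g, 'm) monoid_scheme \<Rightarrow> ('g \<Rightarrow> 'a::unital_cstar_algebra) \<Rightarrow> bool" where
  "spectrally_proper G \<psi> \<longleftrightarrow>
     \<psi> \<in> carrier G \<rightarrow> positive_cone \<and>
     (\<forall>R\<ge>0. finite {g \<in> carrier G. spectral_length \<psi> g \<le> R})"

end

theory Submission
  imports Defs "HOL-Analysis.Topology_Euclidean_Space"
begin

text \<open>
  Both directions are the classical ones for scalar functions on a group, carried out with values in the center
  of the algebra.

  If \<open>\<psi>\<close> is negative definite and spectrally proper, then
  \<open>exp (- \<psi> g / (n + 1))\<close> is positive definite by Schoenberg's theorem
  (\<open>schoenberg_kernel\<close>), tends to \<open>1\<close> at each point, and has norm at most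
  \<open>exp (- spectral_length \<psi> g / (n + 1))\<close>, which vanishes at infinity. Conversely, if
  \<open>h n\<close> witness the Haagerup property, then \<open>1 - Re (h n)\<close> is negative definite and
  positive, and a sum of these with weights \<open>2 ^ k\<close> along a sufficiently fast subsequence converges
  and is spectrally proper (\<open>negative_definite_of_haagerup\<close>).

  The matter behind this is the relation between three notions of positivity. In the algebra, positivity is a
  condition on the spectrum. For self-adjoint elements the norm is attained on the spectrum
  (\<open>spectrum_attains_norm\<close>) and the spectrum is real, so that positivity becomes the norm
  inequality \<open>norm (t - a) \<le> t\<close>; hence the positive elements form a closed convex cone. Square
  roots then give \<open>star a * a \<ge> 0\<close> (\<open>star_mult_self_positive\<close>).

  Positive definiteness is a spectral condition in the matrix algebra, while negative definiteness concerns the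
  algebra-valued form \<open>\<Sum>i j. star (b i) * k i j * b j\<close>. The theorem
  \<open>mat_positive_iff_positive_form\<close> identifies the two points of view without a C*-norm on matrices:
  a form bounded below by \<open>\<epsilon> > 0\<close> is invertible by Gaussian elimination, and an invertible
  positive form is bounded below by some \<open>\<epsilon> > 0\<close>, so that a hermitian matrix with
  nonnegative spectrum can be reached from a large positive shift of it without losing positivity of the form.

  Finally, Schoenberg's theorem needs Schur products, and the real part of a positive definite function needs
  the transpose of a positive matrix. Both fail for general entries. For central entries they follow from one
  elimination argument (\<open>schur_product_transpose_coercive\<close>), in which the pivots and their square
  roots are central and commute past everything else.
\<close>

section \<open>The involution and the complex scalars\<close>

lemma star_0 [simp]: "star (0::'a::unital_cstar_algebra) = 0"
  using star_add[of "0::'a" 0] by simp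

lemma star_1 [simp]: "star (1::'a::unital_cstar_algebra) = 1"
  by (metis mult.right_neutral star_mult star_star)

lemma star_minus [simp]: "star (- x) = - star (x::'a::unital_cstar_algebra)"
  using star_add[of x "- x"] by (simp add: eq_neg_iff_add_eq_0 add.commute)

lemma star_diff: "star (x - y) = star x - star (y::'a::unital_cstar_algebra)"
  using star_add[of x "- y"] by simp

lemma star_scaleR: "star (r *\<^sub>R x) = r *\<^sub>R star (x::'a::unital_cstar_algebra)"
  by (simp add: scaleR_eq_scaleC star_scaleC)

lemma star_of_real [simp]: "star (of_real r) = (of_real r :: 'a::unital_cstar_algebra)"
  by (simp add: of_real_def star_scaleR)

lemma star_sum: "star (sum f I) = (\<Sum>i\<in>I. star (f i :: 'a::unital_cstar_algebra))"
  by (induction I rule: infinite_finite_induct) (auto simp: star_add)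

lemma star_power: "star (x ^ n) = star (x::'a::unital_cstar_algebra) ^ n"
  by (induction n) (auto simp: star_mult power_commutes)

lemma scaleC_of_real: "complex_of_real r *\<^sub>C x = r *\<^sub>R (x::'a::unital_cstar_algebra)"
  by (simp add: scaleR_eq_scaleC)

lemma scaleC_1 [simp]: "1 *\<^sub>C x = (x::'a::unital_cstar_algebra)"
  using scaleC_of_real[of 1 x] by simp

lemma scaleC_0_left [simp]: "0 *\<^sub>C x = (0::'a::unital_cstar_algebra)"
  using scaleC_of_real[of 0 x] by simp

lemma scaleC_0_right [simp]: "c *\<^sub>C (0::'a::unital_cstar_algebra) = 0"
  using scaleC_add_right[of c "0::'a" 0] by simp

lemma scaleC_minus_left: "(- c) *\<^sub>C x = - (c *\<^sub>C (x::'a::unital_cstar_algebra))"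
  using scaleC_add_left[of "- c" c x] by (simp add: eq_neg_iff_add_eq_0)

lemma scaleC_minus_right: "c *\<^sub>C (- x) = - (c *\<^sub>C (x::'a::unital_cstar_algebra))"
  using scaleC_add_right[of c "- x" x] by (simp add: eq_neg_iff_add_eq_0)

lemma scaleC_diff_left: "(c - d) *\<^sub>C x = c *\<^sub>C x - d *\<^sub>C (x::'a::unital_cstar_algebra)"
  using scaleC_add_left[of c "- d" x] by (simp add: scaleC_minus_left)

lemma scaleC_diff_right: "c *\<^sub>C (x - y) = c *\<^sub>C x - c *\<^sub>C (y::'a::unital_cstar_algebra)"
  using scaleC_add_right[of c x "- y"] by (simp add: scaleC_minus_right)

lemma scaleC_one_eq_of_real: "complex_of_real r *\<^sub>C 1 = (of_real r :: 'a::unital_cstar_algebra)"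
  by (simp add: of_real_def scaleR_eq_scaleC)

lemma of_real_mult_left: "of_real r * x = r *\<^sub>R (x::'a::real_normed_algebra_1)"
  by (simp add: of_real_def)

lemma of_real_mult_right: "x * of_real r = r *\<^sub>R (x::'a::real_normed_algebra_1)"
  by (simp add: of_real_def)

text \<open>
  The C*-identity bounds \<open>norm y * norm y\<close> by \<open>norm (star y) * norm y\<close>; applying this
  to \<open>x\<close> and to \<open>star x\<close> gives both inequalities.
\<close>
lemma norm_star [simp]: "norm (star x) = norm (x::'a::unital_cstar_algebra)"
proof -
  have le: "norm y \<le> norm (star y)" for y :: 'a
  proof (cases "y = 0")
    case False
    have "norm y * norm y \<le> norm (star y) * norm y"
      using norm_star_mult_self[of y] norm_mult_ineq[of "star y" y] by (simp add: power2_eq_square)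
    then show ?thesis using False by simp
  qed simp
  show ?thesis using le[of x] le[of "star x"] by (simp add: star_star)
qed

lemma bounded_linear_star: "bounded_linear (star :: 'a::unital_cstar_algebra \<Rightarrow> 'a)"
  by (rule bounded_linear_intro[where K=1]) (auto simp: star_add star_scaleR)

lemma norm_square_self_adjoint:
  "star x = x \<Longrightarrow> norm (x * x) = (norm (x::'a::unital_cstar_algebra))\<^sup>2"
  using norm_star_mult_self[of x] by simp

section \<open>Invertible elements and the spectrum\<close>

definition alg_invertible :: "'a::monoid_mult \<Rightarrow> bool" where
  "alg_invertible a \<longleftrightarrow> (\<exists>b. a * b = 1 \<and> b * a = 1)"

lemma mem_alg_spectrum_iff: "z \<in> alg_spectrum a \<longleftrightarrow> \<not> alg_invertible (z *\<^sub>C 1 - a)"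
  by (simp add: alg_spectrum_def alg_invertible_def)

lemma alg_invertible_mult:
  assumes "alg_invertible a" "alg_invertible b"
  shows "alg_invertible (a * b)"
proof -
  obtain c d where "a * c = 1" "c * a = 1" "b * d = 1" "d * b = 1"
    using assms by (auto simp: alg_invertible_def)
  then have "(a * b) * (d * c) = 1" "(d * c) * (a * b) = 1"
    by (metis mult.assoc mult.right_neutral)+
  then show ?thesis unfolding alg_invertible_def by blast
qed

lemma alg_invertible_factor:
  assumes "alg_invertible (a * b)" "a * b = b * a"
  shows "alg_invertible a"
proof -
  obtain c where c: "(a * b) * c = 1" "c * (a * b) = 1"
    using assms by (auto simp: alg_invertible_def)
  have r: "a * (b * c) = 1" using c(1) by (simp only: mult.assoc)
  have l: "(c * b) * a = 1" using c(2) assms(2) by (simp only: mult.assoc)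
  have "c * b = (c * b) * (a * (b * c))" by (simp only: r mult_1_right)
  also have "\<dots> = ((c * b) * a) * (b * c)" by (simp only: mult.assoc)
  finally have "c * b = b * c" by (simp only: l mult_1_left)
  then show ?thesis unfolding alg_invertible_def using r l by (intro exI[of _ "b * c"]) simp
qed

lemma alg_invertible_scaleC_one:
  "c \<noteq> 0 \<Longrightarrow> alg_invertible (c *\<^sub>C (1::'a::unital_cstar_algebra))"
  unfolding alg_invertible_def
  by (intro exI[of _ "inverse c *\<^sub>C 1"]) (simp add: mult_scaleC_left scaleC_scaleC)

lemma alg_invertible_scaleC:
  assumes "c \<noteq> 0" "alg_invertible (a::'a::unital_cstar_algebra)"
  shows "alg_invertible (c *\<^sub>C a)"
  using alg_invertible_mult[OF alg_invertible_scaleC_one[OF assms(1)] assms(2)]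
  by (simp add: mult_scaleC_left)

lemma alg_invertible_scaleC_iff:
  "c \<noteq> 0 \<Longrightarrow> alg_invertible (c *\<^sub>C a) \<longleftrightarrow> alg_invertible (a::'a::unital_cstar_algebra)"
  using alg_invertible_scaleC[of c a] alg_invertible_scaleC[of "inverse c" "c *\<^sub>C a"]
  by (auto simp: scaleC_scaleC)

lemma alg_invertible_minus_iff:
  "alg_invertible (- a) \<longleftrightarrow> alg_invertible (a::'a::unital_cstar_algebra)"
  using alg_invertible_scaleC_iff[of "-1" a] by (simp add: scaleC_minus_left)

text \<open>
  The inverse is the Neumann series \<open>\<Sum>n. x ^ n\<close>.
\<close>
lemma alg_invertible_one_minus:
  fixes x :: "'a::{real_normed_algebra_1,banach}"
  assumes "norm x < 1"
  shows "alg_invertible (1 - x)"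
proof -
  have sn: "summable (\<lambda>n. norm (x ^ n))"
  proof (rule summable_comparison_test)
    show "summable (\<lambda>n. norm x ^ n)" using assms by (simp add: summable_geometric)
    show "\<exists>N. \<forall>n\<ge>N. norm (norm (x ^ n)) \<le> norm x ^ n" by (simp add: norm_power_ineq)
  qed
  then have s: "summable (\<lambda>n. x ^ n)" by (rule summable_norm_cancel)
  let ?S = "\<Sum>n. x ^ n"
  have S: "?S = 1 + (\<Sum>n. x ^ Suc n)"
    using suminf_split_head[OF s] by simp
  have "x * ?S = (\<Sum>n. x ^ Suc n)"
    using suminf_mult[OF s, of x] by simp
  moreover have "?S * x = (\<Sum>n. x ^ Suc n)"
    using suminf_mult2[OF s, of x] by (simp add: power_commutes)
  ultimately have "(1 - x) * ?S = 1" "?S * (1 - x) = 1"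
    using S by (simp_all add: left_diff_distrib right_diff_distrib)
  then show ?thesis unfolding alg_invertible_def by blast
qed

lemma spectrum_norm_bound:
  assumes "z \<in> alg_spectrum (a::'a::unital_cstar_algebra)"
  shows "cmod z \<le> norm a"
proof (rule ccontr)
  assume n: "\<not> cmod z \<le> norm a"
  then have z: "z \<noteq> 0" using norm_ge_zero[of a] by auto
  have "inverse (cmod z) * norm a < 1" using n z by (simp add: field_simps)
  then have "norm (inverse z *\<^sub>C a) < 1" by (simp add: norm_scaleC norm_inverse)
  from alg_invertible_scaleC[OF z alg_invertible_one_minus[OF this]] show False
    using assms z by (simp add: mem_alg_spectrum_iff scaleC_diff_right scaleC_scaleC)
qed

lemma spectrum_shift:
  "z \<in> alg_spectrum a \<Longrightarrow> z + w \<in> alg_spectrum (a + w *\<^sub>C (1::'a::unital_cstar_algebra))"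
  by (simp add: mem_alg_spectrum_iff scaleC_add_left algebra_simps)

lemma spectrum_reflect:
  "z \<in> alg_spectrum a \<Longrightarrow> w - z \<in> alg_spectrum (w *\<^sub>C (1::'a::unital_cstar_algebra) - a)"
  using alg_invertible_minus_iff[of "z *\<^sub>C 1 - a"]
  by (simp add: mem_alg_spectrum_iff scaleC_diff_left algebra_simps)

lemma spectrum_reflect_real:
  "z \<in> alg_spectrum a \<Longrightarrow> of_real r - z \<in> alg_spectrum (of_real r - (a::'a::unital_cstar_algebra))"
  using spectrum_reflect[of z a "of_real r"] by (simp add: scaleC_one_eq_of_real)

text \<open>
  If \<open>c\<close> inverts \<open>z - b * a\<close>, then \<open>(1 + a * c * b) / z\<close> inverts
  \<open>z - a * b\<close>.
\<close>
lemma spectrum_mult_commute: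
  assumes "z \<in> alg_spectrum (a * b)" "z \<noteq> 0"
  shows "z \<in> alg_spectrum (b * (a::'a::unital_cstar_algebra))"
proof (rule ccontr)
  assume "z \<notin> alg_spectrum (b * a)"
  then obtain c where c: "(z *\<^sub>C 1 - b * a) * c = 1" "c * (z *\<^sub>C 1 - b * a) = 1"
    by (auto simp: mem_alg_spectrum_iff alg_invertible_def)
  define d where "d = inverse z *\<^sub>C (1 + a * c * b)"
  have c': "b * a * c = z *\<^sub>C c - 1" "c * b * a = z *\<^sub>C c - 1"
    using c by (simp_all add: algebra_simps mult_scaleC_left mult_scaleC_right)
  have "(a * b) * (a * c * b) = a * (b * a * c) * b" by (simp add: mult.assoc)
  also have "\<dots> = a * (z *\<^sub>C c - 1) * b" by (simp only: c')
  also have "\<dots> = z *\<^sub>C (a * c * b) - a * b"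
    by (simp add: algebra_simps mult_scaleC_left mult_scaleC_right)
  finally have e1: "(a * b) * (a * c * b) = z *\<^sub>C (a * c * b) - a * b" .
  have "(a * c * b) * (a * b) = a * (c * b * a) * b" by (simp add: mult.assoc)
  also have "\<dots> = a * (z *\<^sub>C c - 1) * b" by (simp only: c')
  also have "\<dots> = z *\<^sub>C (a * c * b) - a * b"
    by (simp add: algebra_simps mult_scaleC_left mult_scaleC_right)
  finally have e2: "(a * c * b) * (a * b) = z *\<^sub>C (a * c * b) - a * b" .
  have "(z *\<^sub>C 1 - a * b) * (1 + a * c * b) = z *\<^sub>C 1"
       "(1 + a * c * b) * (z *\<^sub>C 1 - a * b) = z *\<^sub>C 1"
    using e1 e2
    by (simp_all add: distrib_left distrib_right left_diff_distrib right_diff_distrib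
        mult_scaleC_left mult_scaleC_right scaleC_add_right)
  then have "(z *\<^sub>C 1 - a * b) * d = 1" "d * (z *\<^sub>C 1 - a * b) = 1"
    using assms(2) by (simp_all add: d_def mult_scaleC_left mult_scaleC_right scaleC_scaleC)
  with assms(1) show False by (auto simp: mem_alg_spectrum_iff alg_invertible_def)
qed

section \<open>Self-adjoint elements: the norm is attained on the real spectrum\<close>

lemma norm_power_two_power:
  assumes "star x = (x::'a::unital_cstar_algebra)" "norm x = 1"
  shows "norm (x ^ (2 ^ m)) = 1"
proof (induction m)
  case (Suc m)
  have "x ^ (2 ^ Suc m) = x ^ (2 ^ m) * x ^ (2 ^ m)"
    by (simp add: mult_2 power_add)
  then show ?case
    using Suc norm_square_self_adjoint[of "x ^ (2 ^ m)"] assms by (simp add: star_power)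
qed (simp add: assms)

text \<open>
  The resolvent identity \<open>f \<nu> - f \<mu> = (\<nu> - \<mu>) * f \<nu> * a * f \<mu>\<close> first bounds
  \<open>f \<nu>\<close> by \<open>2 * norm (f \<mu>)\<close> for \<open>\<nu>\<close> close to
  \<open>\<mu>\<close>, and then gives a Lipschitz estimate there.
\<close>
lemma continuous_on_resolvent:
  fixes a :: "'a::unital_cstar_algebra"
  assumes f: "\<And>\<mu>. \<mu> \<in> S \<Longrightarrow> (1 - \<mu> *\<^sub>C a) * f \<mu> = 1 \<and> f \<mu> * (1 - \<mu> *\<^sub>C a) = 1"
  shows "continuous_on S f"
  unfolding continuous_on_iff
proof (intro ballI allI impI)
  fix \<mu> and e :: real assume \<mu>: "\<mu> \<in> S" and e: "0 < e"
  define M where "M = 1 + norm a * norm (f \<mu>)"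
  have M: "M \<ge> 1" by (simp add: M_def)
  define L where "L = 1 + 2 * M * norm (f \<mu>)"
  have L: "L \<ge> 1" using M by (simp add: L_def)
  define d where "d = min (1 / (2 * M)) (e / L)"
  have d: "d > 0" using M L e by (simp add: d_def)
  show "\<exists>d>0. \<forall>\<nu>\<in>S. dist \<nu> \<mu> < d \<longrightarrow> dist (f \<nu>) (f \<mu>) < e"
  proof (intro exI[of _ d] conjI ballI impI d)
    fix \<nu> assume \<nu>: "\<nu> \<in> S" and dist: "dist \<nu> \<mu> < d"
    have "f \<nu> - f \<mu> = f \<nu> * ((1 - \<mu> *\<^sub>C a) * f \<mu>) - (f \<nu> * (1 - \<nu> *\<^sub>C a)) * f \<mu>"
      using f[OF \<mu>] f[OF \<nu>] by simp
    also have "\<dots> = f \<nu> * ((1 - \<mu> *\<^sub>C a) - (1 - \<nu> *\<^sub>C a)) * f \<mu>"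
      by (simp add: left_diff_distrib right_diff_distrib mult.assoc)
    also have "\<dots> = (\<nu> - \<mu>) *\<^sub>C (f \<nu> * a * f \<mu>)"
      by (simp add: scaleC_diff_left left_diff_distrib right_diff_distrib mult_scaleC_left mult_scaleC_right)
    finally have "norm (f \<nu> - f \<mu>) = dist \<nu> \<mu> * norm (f \<nu> * a * f \<mu>)"
      by (simp add: norm_scaleC dist_norm)
    also have "\<dots> \<le> dist \<nu> \<mu> * (norm (f \<nu>) * norm a * norm (f \<mu>))"
      by (intro mult_left_mono order_trans[OF norm_mult_ineq] mult_right_mono norm_mult_ineq) auto
    also have "\<dots> \<le> dist \<nu> \<mu> * (norm (f \<nu>) * M)"
      by (intro mult_left_mono) (auto simp: M_def algebra_simps)
    finally have 1: "norm (f \<nu> - f \<mu>) \<le> dist \<nu> \<mu> * M * norm (f \<nu>)" by (simp add: mult_ac)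
    have "dist \<nu> \<mu> \<le> 1 / (2 * M)" using dist by (simp add: d_def)
    then have "dist \<nu> \<mu> * M \<le> 1 / 2" using M by (simp add: field_simps)
    then have "dist \<nu> \<mu> * M * norm (f \<nu>) \<le> 1 / 2 * norm (f \<nu>)"
      by (rule mult_right_mono) simp
    with 1 have "norm (f \<nu> - f \<mu>) \<le> 1 / 2 * norm (f \<nu>)" by linarith
    moreover have "norm (f \<nu>) \<le> norm (f \<mu>) + norm (f \<nu> - f \<mu>)"
      by (metis add.commute diff_add_cancel norm_triangle_ineq)
    ultimately have "norm (f \<nu>) \<le> 2 * norm (f \<mu>)" by linarith
    then have "dist \<nu> \<mu> * M * norm (f \<nu>) \<le> dist \<nu> \<mu> * M * (2 * norm (f \<mu>))"
      using M by (intro mult_left_mono) auto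
    with 1 have "norm (f \<nu> - f \<mu>) \<le> dist \<nu> \<mu> * (2 * M * norm (f \<mu>))" by (simp add: mult_ac)
    also have "\<dots> \<le> dist \<nu> \<mu> * L" by (intro mult_left_mono) (auto simp: L_def)
    also have "\<dots> < e" using dist L by (simp add: d_def field_simps)
    finally show "dist (f \<nu>) (f \<mu>) < e" by (simp add: dist_norm)
  qed
qed

lemma root_of_minus_one: "\<exists>\<zeta>. cmod \<zeta> = 1 \<and> \<zeta> ^ (2 ^ m) = - 1"
  by (rule exI[of _ "cis (pi / 2 ^ m)"]) (simp add: DeMoivre)

text \<open>
  This is the self-adjoint case of the spectral radius formula. If the spectrum stayed inside the open unit
  disc, \<open>f \<mu> = (1 - \<mu> * x)\<inverse>\<close> would be uniformly continuous on the closed disc.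
  Averaging, \<open>(1 - u * u)\<inverse> = ((1 - u)\<inverse> + (1 + u)\<inverse>) / 2\<close>, shows that
  \<open>P m \<mu> = (1 - (\<mu> * x) ^ (2 ^ m))\<inverse>\<close> exists and has the same modulus of continuity
  for every \<open>m\<close>. For \<open>\<mu> = r < 1\<close> it tends to \<open>1\<close> as \<open>m\<close>
  grows, so \<open>P m 1\<close> gets close to \<open>1\<close>, which makes \<open>x ^ (2 ^ m)\<close> small.
  But powers of exponent \<open>2 ^ m\<close> of a self-adjoint element of norm one have norm one.
\<close>
lemma spectrum_reaches_unit_circle:
  fixes x :: "'a::unital_cstar_algebra"
  assumes sa: "star x = x" and n1: "norm x = 1"
  shows "\<exists>z\<in>alg_spectrum x. cmod z \<ge> 1"
proof (rule ccontr)
  assume no: "\<not> ?thesis"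
  have inv: "alg_invertible (1 - \<mu> *\<^sub>C x)" if "cmod \<mu> \<le> 1" for \<mu>
  proof (cases "\<mu> = 0")
    case True
    then show ?thesis by (auto simp: alg_invertible_def)
  next
    case False
    then have "inverse (cmod \<mu>) \<ge> 1" using that by (simp add: field_simps)
    then have "cmod (inverse \<mu>) \<ge> 1" by (simp add: norm_inverse)
    then have "alg_invertible (inverse \<mu> *\<^sub>C 1 - x)" using no by (auto simp: mem_alg_spectrum_iff)
    from alg_invertible_scaleC[OF False this] False show ?thesis
      by (simp add: scaleC_diff_right scaleC_scaleC)
  qed
  define f where "f \<mu> = (SOME b. (1 - \<mu> *\<^sub>C x) * b = 1 \<and> b * (1 - \<mu> *\<^sub>C x) = 1)" for \<mu>
  have f: "(1 - \<mu> *\<^sub>C x) * f \<mu> = 1 \<and> f \<mu> * (1 - \<mu> *\<^sub>C x) = 1" if "\<mu> \<in> cball 0 1" for \<mu>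
  proof -
    have "\<exists>b. (1 - \<mu> *\<^sub>C x) * b = 1 \<and> b * (1 - \<mu> *\<^sub>C x) = 1"
      using inv[of \<mu>] that by (simp add: alg_invertible_def)
    then show ?thesis unfolding f_def by (rule someI_ex)
  qed
  have "uniformly_continuous_on (cball 0 1) f"
    by (intro compact_uniformly_continuous continuous_on_resolvent[of _ x] f) auto
  then obtain d where d: "d > 0"
    "\<And>\<mu> \<nu>. cmod \<mu> \<le> 1 \<Longrightarrow> cmod \<nu> \<le> 1 \<Longrightarrow> cmod (\<mu> - \<nu>) < d \<Longrightarrow> norm (f \<mu> - f \<nu>) < 1/4"
    unfolding uniformly_continuous_on_def dist_norm
    by (metis dist_0_norm mem_cball zero_less_divide_1_iff zero_less_numeral)
  obtain \<zeta> where \<zeta>: "\<And>m. cmod (\<zeta> m) = 1" "\<And>m. \<zeta> m ^ (2 ^ m) = - 1"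
    using root_of_minus_one by metis
  define P where "P = rec_nat f (\<lambda>m p \<mu>. (1/2) *\<^sub>R (p \<mu> + p (\<zeta> m * \<mu>)))"
  have P0: "P 0 = f" and PS: "P (Suc m) \<mu> = (1/2) *\<^sub>R (P m \<mu> + P m (\<zeta> m * \<mu>))" for m \<mu>
    by (simp_all add: P_def)
  have Pinv: "(1 - (\<mu> ^ (2 ^ m)) *\<^sub>C x ^ (2 ^ m)) * P m \<mu> = 1" if "cmod \<mu> \<le> 1" for m \<mu>
    using that
  proof (induction m arbitrary: \<mu>)
    case 0
    then show ?case using f by (simp add: P0)
  next
    case (Suc m)
    define u where "u = (\<mu> ^ (2 ^ m)) *\<^sub>C x ^ (2 ^ m)"
    have sq: "(\<mu> ^ (2 ^ Suc m)) *\<^sub>C x ^ (2 ^ Suc m) = u * u"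
      by (simp add: u_def mult_2 power_add mult_scaleC_left mult_scaleC_right scaleC_scaleC)
    have 1: "(1 - u) * P m \<mu> = 1" using Suc.IH[OF Suc.prems] by (simp add: u_def)
    have 2: "(1 + u) * P m (\<zeta> m * \<mu>) = 1"
      using Suc.IH[of "\<zeta> m * \<mu>"] Suc.prems \<zeta>
      by (simp add: u_def norm_mult power_mult_distrib scaleC_minus_left)
    have "(1 - u * u) * P m \<mu> = (1 + u) * ((1 - u) * P m \<mu>)"
      by (simp add: algebra_simps)
    moreover have "(1 - u * u) * P m (\<zeta> m * \<mu>) = (1 - u) * ((1 + u) * P m (\<zeta> m * \<mu>))"
      by (simp add: algebra_simps)
    ultimately have "(1 - u * u) * (P m \<mu> + P m (\<zeta> m * \<mu>)) = 2"
      using 1 2 by (simp add: distrib_left)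
    moreover have "(1/2) *\<^sub>R (2::'a) = 1"
      by (metis of_real_def of_real_numeral scaleR_scaleR scaleR_one nonzero_eq_divide_eq
          divide_inverse mult.commute mult_1 zero_neq_numeral)
    ultimately show ?case unfolding sq PS by simp
  qed
  have Puc: "norm (P m \<mu> - P m \<nu>) < 1/4"
    if "cmod \<mu> \<le> 1" "cmod \<nu> \<le> 1" "cmod (\<mu> - \<nu>) < d" for m \<mu> \<nu>
    using that
  proof (induction m arbitrary: \<mu> \<nu>)
    case 0
    then show ?case using d by (simp add: P0)
  next
    case (Suc m)
    have "cmod (\<zeta> m * \<mu> - \<zeta> m * \<nu>) = cmod (\<mu> - \<nu>)"
      by (metis \<zeta>(1) mult_1 norm_mult right_diff_distrib)
    then have 1: "norm (P m (\<zeta> m * \<mu>) - P m (\<zeta> m * \<nu>)) < 1/4"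
      using Suc \<zeta> by (simp add: norm_mult)
    have 2: "norm (P m \<mu> - P m \<nu>) < 1/4" using Suc by simp
    have "P (Suc m) \<mu> - P (Suc m) \<nu>
        = (1/2) *\<^sub>R ((P m \<mu> - P m \<nu>) + (P m (\<zeta> m * \<mu>) - P m (\<zeta> m * \<nu>)))"
      by (simp add: PS algebra_simps)
    then have "norm (P (Suc m) \<mu> - P (Suc m) \<nu>)
        = norm ((P m \<mu> - P m \<nu>) + (P m (\<zeta> m * \<mu>) - P m (\<zeta> m * \<nu>))) / 2"
      by simp
    moreover have "norm ((P m \<mu> - P m \<nu>) + (P m (\<zeta> m * \<mu>) - P m (\<zeta> m * \<nu>))) < 1/4 + 1/4"
      by (rule norm_add_less[OF 2 1])
    ultimately show ?case by simp
  qed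
  \<comment> \<open>\<open>r\<close> lies inside the disc but within the modulus of continuity \<open>d\<close> of the point \<open>1\<close>.\<close>
  define r where "r = max 0 (1 - d / 2)"
  have r: "0 \<le> r" "r < 1" "1 - r < d" using d(1) by (auto simp: r_def)
  obtain k where k: "r ^ k < 1/8" using real_arch_pow_inv[of "1/8" r] r by auto
  define m where "m = k"
  have "k \<le> 2 ^ m" by (simp add: m_def less_imp_le)
  then have rm: "r ^ (2 ^ m) < 1/8"
    using k r power_decreasing[of k "2 ^ m" r] by simp
  define v where "v = (complex_of_real r ^ (2 ^ m)) *\<^sub>C x ^ (2 ^ m)"
  define p where "p = P m (complex_of_real r)"
  have nv: "norm v < 1/8"
    using rm r norm_power_two_power[OF sa n1] by (simp add: v_def norm_scaleC norm_power)
  have "(1 - v) * p = 1" using Pinv[of "complex_of_real r" m] r by (simp add: v_def p_def)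
  then have p: "p - 1 = v * p" by (simp add: algebra_simps)
  have vp: "norm (v * p) \<le> 1/8 * norm p"
    using norm_mult_ineq[of v p] mult_right_mono[of "norm v" "1/8" "norm p"] nv by simp
  have "norm p \<le> 1 + norm (p - 1)" using norm_triangle_ineq[of 1 "p - 1"] by simp
  with vp p have p1: "norm (p - 1) \<le> 1/7" by simp
  define q where "q = P m 1"
  have "cmod (1 - complex_of_real r) < d"
    using r by (metis abs_of_pos diff_gt_0_iff_gt norm_of_real of_real_1 of_real_diff)
  then have "norm (q - p) < 1/4" unfolding q_def p_def using r by (intro Puc) auto
  then have q1: "norm (q - 1) < 2/5"
    using p1 norm_triangle_ineq[of "q - p" "p - 1"] by simp
  define u where "u = x ^ (2 ^ m)"
  have u: "norm u = 1" using norm_power_two_power[OF sa n1] by (simp add: u_def)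
  have "(1 - u) * q = 1" using Pinv[of 1 m] by (simp add: u_def q_def)
  then have "u = (q - 1) - u * (q - 1)" by (simp add: algebra_simps)
  then have "norm u \<le> norm (q - 1) + norm (u * (q - 1))"
    by (metis norm_triangle_ineq4)
  also have "\<dots> \<le> norm (q - 1) + norm u * norm (q - 1)" using norm_mult_ineq by simp
  finally show False using u q1 by simp
qed

lemma spectrum_attains_norm:
  fixes a :: "'a::unital_cstar_algebra"
  assumes "star a = a"
  obtains z where "z \<in> alg_spectrum a" "cmod z = norm a"
proof (cases "a = 0")
  case True
  have "0 \<in> alg_spectrum a" using True by (auto simp: mem_alg_spectrum_iff alg_invertible_def)
  then show ?thesis using that True by auto
next
  case False
  let ?c = "complex_of_real (norm a)"
  define x where "x = inverse (norm a) *\<^sub>R a"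
  have "star x = x" "norm x = 1" using assms False by (simp_all add: x_def star_scaleR)
  then obtain z where z: "z \<in> alg_spectrum x" "cmod z \<ge> 1"
    using spectrum_reaches_unit_circle by blast
  have "a = ?c *\<^sub>C x" using False by (simp add: x_def scaleC_of_real)
  then have "?c * z \<in> alg_spectrum a"
    using z(1) False alg_invertible_scaleC_iff[of ?c "z *\<^sub>C 1 - x"]
    by (simp add: mem_alg_spectrum_iff scaleC_diff_right scaleC_scaleC)
  moreover from spectrum_norm_bound[OF this] have "cmod (?c * z) = norm a"
    using z(2) False by (intro antisym) (auto simp: norm_mult)
  ultimately show ?thesis by (rule that)
qed

text \<open>
  Arens' trick: a spectral value \<open>z\<close> of \<open>a\<close> moves to \<open>z + \<i> * t\<close> in
  the spectrum of \<open>a + \<i> * t\<close>, whose norm squared is at most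
  \<open>(norm a)\<^sup>2 + t\<^sup>2\<close>. Comparing the terms that are linear in \<open>t\<close> forces
  \<open>Im z = 0\<close>.
\<close>
lemma spectrum_self_adjoint_real:
  fixes a :: "'a::unital_cstar_algebra"
  assumes sa: "star a = a" and z: "z \<in> alg_spectrum a"
  shows "Im z = 0"
proof (rule ccontr)
  assume y: "Im z \<noteq> 0"
  define t where "t = ((norm a)\<^sup>2 + 1) / (2 * Im z)"
  define w where "w = \<i> * complex_of_real t"
  have cw: "cnj w = - w" and ww: "w * w = - complex_of_real (t\<^sup>2)"
    by (simp_all add: w_def power2_eq_square algebra_simps)
  have "star (a + w *\<^sub>C 1) = a - w *\<^sub>C 1"
    by (simp add: star_add star_scaleC sa cw scaleC_minus_left)
  then have "star (a + w *\<^sub>C 1) * (a + w *\<^sub>C 1) = (a - w *\<^sub>C 1) * (a + w *\<^sub>C 1)" by simp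
  also have "\<dots> = a * a - (w * w) *\<^sub>C 1"
    by (simp add: algebra_simps mult_scaleC_left mult_scaleC_right scaleC_scaleC scaleC_diff_right)
  also have "\<dots> = a * a + of_real (t\<^sup>2)"
    by (simp only: ww scaleC_minus_left scaleC_one_eq_of_real diff_minus_eq_add)
  finally have "star (a + w *\<^sub>C 1) * (a + w *\<^sub>C 1) = a * a + of_real (t\<^sup>2)" .
  then have "(norm (a + w *\<^sub>C 1))\<^sup>2 = norm (a * a + of_real (t\<^sup>2))"
    by (metis norm_star_mult_self)
  also have "\<dots> \<le> (norm a)\<^sup>2 + t\<^sup>2"
    using norm_triangle_ineq[of "a * a" "of_real (t\<^sup>2)"] norm_square_self_adjoint[OF sa]
      norm_of_real[of "t\<^sup>2", where ?'a='a] by (simp del: of_real_power)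
  finally have "(cmod (z + w))\<^sup>2 \<le> (norm a)\<^sup>2 + t\<^sup>2"
    using spectrum_norm_bound[OF spectrum_shift[OF z, of w]] by (smt (verit) norm_ge_zero power_mono)
  then have "(Re z)\<^sup>2 + (Im z + t)\<^sup>2 \<le> (norm a)\<^sup>2 + t\<^sup>2" by (simp add: cmod_power2 w_def)
  then have "(Im z)\<^sup>2 + 2 * Im z * t \<le> (norm a)\<^sup>2"
    by (smt (verit) power2_sum zero_le_power2)
  moreover have "2 * Im z * t = (norm a)\<^sup>2 + 1" using y by (simp add: t_def)
  ultimately show False by (smt (verit) zero_le_power2)
qed

section \<open>The positive cone\<close>

lemma positive_cone_self_adjoint: "a \<in> positive_cone \<Longrightarrow> star a = a"
  by (simp add: positive_cone_def)

lemma positive_cone_iff_Re: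
  "a \<in> positive_cone \<longleftrightarrow> star a = (a::'a::unital_cstar_algebra) \<and> (\<forall>z\<in>alg_spectrum a. Re z \<ge> 0)"
  by (auto simp: positive_cone_def complex_nonneg_Reals_iff spectrum_self_adjoint_real)

text \<open>
  For \<open>norm a \<le> t\<close>, positivity of \<open>a\<close> means that \<open>t - a\<close> has its
  spectrum in \<open>{-t..t}\<close>, hence norm at most \<open>t\<close>, because a self-adjoint element
  attains its norm on its real spectrum. Being a norm condition, this makes the cone convex and closed.
\<close>
lemma positive_cone_norm_char:
  fixes a :: "'a::unital_cstar_algebra"
  shows "star a = a \<Longrightarrow> norm (of_real t - a) \<le> t \<Longrightarrow> a \<in> positive_cone"
    and "a \<in> positive_cone \<Longrightarrow> norm a \<le> t \<Longrightarrow> norm (of_real t - a) \<le> t"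
proof -
  assume sa: "star a = a" and n: "norm (of_real t - a) \<le> t"
  have "Re z \<ge> 0" if "z \<in> alg_spectrum a" for z
    using spectrum_norm_bound[OF spectrum_reflect_real[OF that, of t]] n
      abs_Re_le_cmod[of "of_real t - z"] by simp
  with sa show "a \<in> positive_cone" by (simp add: positive_cone_iff_Re)
next
  assume a: "a \<in> positive_cone" and n: "norm a \<le> t"
  have sa: "star a = a" using a by (rule positive_cone_self_adjoint)
  then have "star (of_real t - a) = of_real t - a" by (simp add: star_diff)
  then obtain z where z: "z \<in> alg_spectrum (of_real t - a)" "cmod z = norm (of_real t - a)"
    by (rule spectrum_attains_norm)
  from spectrum_reflect_real[OF z(1), of t] have w: "of_real t - z \<in> alg_spectrum a" by simp
  have "Im z = 0" using spectrum_self_adjoint_real[OF sa w] by simp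
  moreover have "Re z \<le> t" using a w by (force simp: positive_cone_iff_Re)
  moreover have "Re z \<ge> 0"
    using spectrum_norm_bound[OF w] n abs_Re_le_cmod[of "of_real t - z"] by simp
  ultimately show "norm (of_real t - a) \<le> t" using z(2) by (simp add: cmod_def)
qed

lemma positive_cone_add:
  fixes a b :: "'a::unital_cstar_algebra"
  assumes "a \<in> positive_cone" "b \<in> positive_cone"
  shows "a + b \<in> positive_cone"
proof (rule positive_cone_norm_char(1))
  show "star (a + b) = a + b" using assms by (simp add: star_add positive_cone_self_adjoint)
  have "of_real (norm a + norm b) - (a + b) = (of_real (norm a) - a) + (of_real (norm b) - b)"
    by simp
  then show "norm (of_real (norm a + norm b) - (a + b)) \<le> norm a + norm b"
    using norm_triangle_mono[OF positive_cone_norm_char(2)[OF assms(1) order_refl]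
        positive_cone_norm_char(2)[OF assms(2) order_refl]] by (simp only:)
qed

lemma positive_cone_of_real:
  "c \<ge> 0 \<Longrightarrow> (of_real c :: 'a::unital_cstar_algebra) \<in> positive_cone"
  by (rule positive_cone_norm_char(1)[of _ c]) simp_all

lemma positive_cone_0 [simp]: "(0 :: 'a::unital_cstar_algebra) \<in> positive_cone"
  using positive_cone_of_real[of 0] by simp

lemma positive_cone_scaleR:
  fixes a :: "'a::unital_cstar_algebra"
  assumes "a \<in> positive_cone" "c \<ge> 0"
  shows "c *\<^sub>R a \<in> positive_cone"
proof (rule positive_cone_norm_char(1))
  show "star (c *\<^sub>R a) = c *\<^sub>R a" using assms by (simp add: star_scaleR positive_cone_self_adjoint)
  have "of_real (c * norm a) - c *\<^sub>R a = c *\<^sub>R (of_real (norm a) - a)"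
    by (simp add: of_real_def scaleR_diff_right)
  then show "norm (of_real (c * norm a) - c *\<^sub>R a) \<le> c * norm a"
    using positive_cone_norm_char(2)[OF assms(1), of "norm a"] assms(2) by (simp add: mult_left_mono)
qed

lemma positive_cone_sum:
  "(\<And>i. i \<in> I \<Longrightarrow> f i \<in> positive_cone) \<Longrightarrow> sum f I \<in> (positive_cone :: 'a::unital_cstar_algebra set)"
  by (induction I rule: infinite_finite_induct) (auto intro: positive_cone_add)

lemma positive_cone_limit:
  fixes f :: "nat \<Rightarrow> 'a::unital_cstar_algebra"
  assumes pos: "\<And>n. f n \<in> positive_cone" and lim: "f \<longlonglongrightarrow> a"
  shows "a \<in> positive_cone"
proof (rule positive_cone_norm_char(1))
  have "(\<lambda>n. star (f n)) \<longlonglongrightarrow> star a"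
    by (rule bounded_linear.tendsto[OF bounded_linear_star lim])
  then show "star a = a"
    using lim pos LIMSEQ_unique by (simp add: positive_cone_self_adjoint)
  have "(\<lambda>n. norm (of_real (norm (f n)) - f n)) \<longlonglongrightarrow> norm (of_real (norm a) - a)"
    by (intro tendsto_intros lim)
  then show "norm (of_real (norm a) - a) \<le> norm a"
    by (rule LIMSEQ_le[OF _ tendsto_norm[OF lim]])
      (use positive_cone_norm_char(2)[OF pos order_refl] in blast)
qed

lemma self_adjoint_le_norm:
  fixes a :: "'a::unital_cstar_algebra"
  assumes "star a = a" "norm a \<le> t"
  shows "of_real t - a \<in> positive_cone"
  by (rule positive_cone_norm_char(1)[of _ t]) (use assms in \<open>simp_all add: star_diff\<close>)

text \<open>
  The spectrum of such an \<open>a\<close> lies in \<open>{0}\<close> and reaches modulus \<open>norm a\<close>.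
\<close>
lemma positive_cone_pointed:
  fixes a :: "'a::unital_cstar_algebra"
  assumes "a \<in> positive_cone" "- a \<in> positive_cone"
  shows "a = 0"
proof -
  have sa: "star a = a" using assms(1) by (rule positive_cone_self_adjoint)
  obtain z where z: "z \<in> alg_spectrum a" "cmod z = norm a" by (rule spectrum_attains_norm[OF sa])
  have "- z \<in> alg_spectrum (- a)" using spectrum_reflect_real[OF z(1), of 0] by simp
  then have "Re z \<le> 0" "Re z \<ge> 0" using assms z(1) by (force simp: positive_cone_iff_Re)+
  moreover have "Im z = 0" using spectrum_self_adjoint_real[OF sa z(1)] .
  ultimately show ?thesis using z(2) by (simp add: cmod_def)
qed

section \<open>Square roots and the positivity of \<open>star a * a\<close>\<close>

text \<open>
  With \<open>p = 1 - x\<close>, the root is \<open>1 - l\<close> for a solution \<open>l\<close> of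
  \<open>2 * l = x + l * l\<close>, found by iterating \<open>y \<mapsto> (x + y * y) / 2\<close> from
  \<open>0\<close>. The same iteration for the number \<open>x = 1\<close> gives an increasing sequence
  \<open>t\<close> bounded by \<open>1\<close>, and the increments of \<open>y\<close> are dominated by those of
  \<open>t\<close>; this yields convergence although the iteration is no strict contraction. Whatever commutes
  with \<open>p\<close> commutes with every iterate.
\<close>
lemma positive_sqrt_of_contraction:
  fixes p :: "'a::unital_cstar_algebra"
  assumes p: "star p = p" "norm (1 - p) \<le> 1"
  obtains s where "s \<in> positive_cone" "s * s = p" "\<And>b. p * b = b * p \<Longrightarrow> s * b = b * s"
proof -
  define x where "x = 1 - p"
  have x: "star x = x" "norm x \<le> 1" using p by (simp_all add: x_def star_diff)
  define y where "y = rec_nat 0 (\<lambda>_ y. (1/2) *\<^sub>R (x + y * y))"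
  have y0: "y 0 = 0" and yS: "\<And>n. y (Suc n) = (1/2) *\<^sub>R (x + y n * y n)"
    by (simp_all add: y_def)
  define t where "t = rec_nat (0::real) (\<lambda>_ t. (1/2) * (1 + t * t))"
  have t0: "t 0 = 0" and tS: "\<And>n. t (Suc n) = (1/2) * (1 + t n * t n)"
    by (simp_all add: t_def)
  have t01: "0 \<le> t n \<and> t n \<le> 1" for n
  proof (induction n)
    case (Suc n)
    then have "t n * t n \<le> 1" by (simp add: mult_le_one)
    with Suc show ?case by (simp add: tS)
  qed (simp add: t0)
  have tinc: "t n \<le> t (Suc n)" for n
  proof -
    have "0 \<le> (1 - t n)\<^sup>2" by simp
    then show ?thesis by (simp add: tS power2_eq_square algebra_simps)
  qed
  have "convergent t"
    using t01 tinc by (intro Bseq_monoseq_convergent BseqI'[of _ 1]) (auto simp: monoseq_Suc)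
  then have ct: "Cauchy t" by (rule convergent_Cauchy)
  have yb: "norm (y n) \<le> t n" for n
  proof (induction n)
    case (Suc n)
    have "norm (x + y n * y n) \<le> norm x + norm (y n * y n)" by (rule norm_triangle_ineq)
    also have "\<dots> \<le> 1 + t n * t n"
      using x(2) Suc t01 by (intro add_mono order_trans[OF norm_mult_ineq] mult_mono) auto
    finally show ?case by (simp add: yS tS)
  qed (simp add: y0 t0)
  have ycomm: "y n * b = b * y n" if "x * b = b * x" for n b
  proof (induction n)
    case (Suc n)
    have "y n * y n * b = b * (y n * y n)" using Suc by (metis mult.assoc)
    then show ?case using that by (simp add: yS distrib_left distrib_right)
  qed (simp add: y0)
  have ysa: "star (y n) = y n" for n
    by (induction n) (simp_all add: y0 yS star_scaleR star_add star_mult x(1))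
  have step: "norm (y (Suc n) - y n) \<le> t (Suc n) - t n" for n
  proof (induction n)
    case 0
    then show ?case using x(2) by (simp add: y0 yS t0 tS)
  next
    case (Suc n)
    have "y (Suc n) * y n = y n * y (Suc n)" by (intro ycomm ycomm[symmetric]) simp
    then have "y (Suc (Suc n)) - y (Suc n) = (1/2) *\<^sub>R ((y (Suc n) - y n) * (y (Suc n) + y n))"
      unfolding yS[of "Suc n"] yS[of n, THEN sym, THEN arg_cong[where f="\<lambda>u. _ - u"]]
      by (subst (3) yS) (simp add: algebra_simps)
    then have "norm (y (Suc (Suc n)) - y (Suc n))
        = (1/2) * norm ((y (Suc n) - y n) * (y (Suc n) + y n))" by simp
    also have "\<dots> \<le> (1/2) * ((t (Suc n) - t n) * (t (Suc n) + t n))"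
      using Suc yb tinc t01
      by (intro mult_left_mono order_trans[OF norm_mult_ineq] mult_mono order_trans[OF norm_triangle_ineq]
          add_mono) (auto simp: diff_ge_0_iff_ge)
    also have "\<dots> = t (Suc (Suc n)) - t (Suc n)"
      unfolding tS[of "Suc n"] by (subst (5) tS) (simp add: algebra_simps)
    finally show ?case .
  qed
  have diff: "norm (y n - y m) \<le> \<bar>t n - t m\<bar>" for n m
  proof -
    have le: "norm (y (m + k) - y m) \<le> t (m + k) - t m" for m k
    proof (induction k)
      case (Suc k)
      then show ?case using step[of "m + k"] norm_triangle_ineq[of "y (Suc (m+k)) - y (m+k)" "y (m+k) - y m"]
        by simp
    qed simp
    show ?thesis
    proof (cases "m \<le> n")
      case True
      then show ?thesis using le[of m "n - m"] by simp
    next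
      case False
      then show ?thesis using le[of n "m - n"] by (simp add: norm_minus_commute)
    qed
  qed
  have "Cauchy y"
  proof (rule metric_CauchyI)
    fix e :: real assume "0 < e"
    then obtain M where "\<forall>m\<ge>M. \<forall>n\<ge>M. dist (t m) (t n) < e" using metric_CauchyD[OF ct] by blast
    then show "\<exists>M. \<forall>m\<ge>M. \<forall>n\<ge>M. dist (y m) (y n) < e"
      unfolding dist_norm real_norm_def by (blast intro: le_less_trans[OF diff])
  qed
  then obtain l where l: "y \<longlonglongrightarrow> l" using Cauchy_convergent convergent_def by blast
  have "(\<lambda>n. (1/2) *\<^sub>R (x + y n * y n)) \<longlonglongrightarrow> (1/2) *\<^sub>R (x + l * l)" by (intro tendsto_intros l)
  moreover have "(\<lambda>n. (1/2) *\<^sub>R (x + y n * y n)) \<longlonglongrightarrow> l" using LIMSEQ_Suc[OF l] by (simp add: yS)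
  ultimately have "l = (1/2) *\<^sub>R (x + l * l)" by (rule LIMSEQ_unique[symmetric])
  then have "2 *\<^sub>R l = 2 *\<^sub>R ((1/2) *\<^sub>R (x + l * l))" by (rule arg_cong)
  then have l2: "2 *\<^sub>R l = x + l * l" by simp
  have lsa: "star l = l"
    using bounded_linear.tendsto[OF bounded_linear_star l] l LIMSEQ_unique by (simp add: ysa)
  have ln: "norm l \<le> 1"
    by (rule LIMSEQ_le_const2[OF tendsto_norm[OF l]]) (meson yb t01 order_trans)
  show ?thesis
  proof (rule that)
    show "1 - l \<in> positive_cone"
      using self_adjoint_le_norm[OF lsa, of 1] ln by simp
    show "(1 - l) * (1 - l) = p"
      using l2 by (simp add: x_def algebra_simps scaleR_2)
    show "(1 - l) * b = b * (1 - l)" if "p * b = b * p" for b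
    proof -
      have "x * b = b * x" using that by (simp add: x_def algebra_simps)
      then have "y n * b = b * y n" for n by (rule ycomm)
      moreover have "(\<lambda>n. y n * b) \<longlonglongrightarrow> l * b" "(\<lambda>n. b * y n) \<longlonglongrightarrow> b * l" by (intro tendsto_intros l)+
      ultimately have "l * b = b * l" using LIMSEQ_unique by simp
      then show ?thesis by (simp add: algebra_simps)
    qed
  qed
qed

text \<open>
  Rescale \<open>p\<close> to norm at most one.
\<close>
lemma positive_sqrt:
  fixes p :: "'a::unital_cstar_algebra"
  assumes p: "p \<in> positive_cone"
  obtains s where "s \<in> positive_cone" "s * s = p" "\<And>b. p * b = b * p \<Longrightarrow> s * b = b * s"
proof -
  define c where "c = norm p + 1"
  have c: "c > 0" "norm p \<le> c" by (simp_all add: c_def add_nonneg_pos)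
  have "of_real c - p = c *\<^sub>R (1 - inverse c *\<^sub>R p)"
    using c by (simp add: of_real_def scaleR_diff_right)
  then have "norm (of_real c - p) = c * norm (1 - inverse c *\<^sub>R p)" using c(1) by simp
  then have n: "norm (1 - inverse c *\<^sub>R p) \<le> 1"
    using positive_cone_norm_char(2)[OF p c(2)] c(1) by simp
  have "star (inverse c *\<^sub>R p) = inverse c *\<^sub>R p"
    using p by (simp add: star_scaleR positive_cone_self_adjoint)
  then obtain s where s: "s \<in> positive_cone" "s * s = inverse c *\<^sub>R p"
      "\<And>b. inverse c *\<^sub>R p * b = b * inverse c *\<^sub>R p \<Longrightarrow> s * b = b * s"
    by (rule positive_sqrt_of_contraction[OF _ n]) blast
  show ?thesis
  proof (rule that[of "sqrt c *\<^sub>R s"])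
    show "sqrt c *\<^sub>R s \<in> positive_cone" using s(1) c by (simp add: positive_cone_scaleR)
    have "sqrt c *\<^sub>R s * sqrt c *\<^sub>R s = (sqrt c * sqrt c) *\<^sub>R (s * s)" by simp
    also have "\<dots> = p" using c(1) by (simp add: s(2))
    finally show "sqrt c *\<^sub>R s * sqrt c *\<^sub>R s = p" .
    show "sqrt c *\<^sub>R s * b = b * sqrt c *\<^sub>R s" if "p * b = b * p" for b
      using s(3)[of b] that by simp
  qed
qed

text \<open>
  A negative spectral value \<open>z = w * w\<close> has \<open>w\<close> purely imaginary, and then both
  factors of \<open>z - a * a = (w - a) * (w + a)\<close> are invertible since the spectrum of \<open>a\<close>
  is real.
\<close>
lemma square_self_adjoint_positive:
  fixes a :: "'a::unital_cstar_algebra"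
  assumes sa: "star a = a"
  shows "a * a \<in> positive_cone"
  unfolding positive_cone_iff_Re
proof (intro conjI ballI)
  show aa: "star (a * a) = a * a" by (simp add: star_mult sa)
  fix z assume z: "z \<in> alg_spectrum (a * a)"
  show "0 \<le> Re z"
  proof (rule ccontr)
    assume neg: "\<not> 0 \<le> Re z"
    define w where "w = \<i> * complex_of_real (sqrt (- Re z))"
    have "sqrt (- Re z) * sqrt (- Re z) = - Re z" using neg by (simp only: real_sqrt_mult_self)
    then have ww: "w * w = z"
      using spectrum_self_adjoint_real[OF aa z] by (simp add: w_def complex_eq_iff)
    have inv: "alg_invertible (v *\<^sub>C 1 - a)" if "Im v \<noteq> 0" for v
      using spectrum_self_adjoint_real[OF sa, of v] that by (auto simp: mem_alg_spectrum_iff)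
    have "alg_invertible (w *\<^sub>C 1 - a)" "alg_invertible ((- w) *\<^sub>C 1 - a)"
      using neg by (auto simp: w_def intro!: inv)
    then have "alg_invertible (- ((w *\<^sub>C 1 - a) * ((- w) *\<^sub>C 1 - a)))"
      by (simp only: alg_invertible_minus_iff alg_invertible_mult)
    moreover have "- ((w *\<^sub>C 1 - a) * ((- w) *\<^sub>C 1 - a)) = z *\<^sub>C 1 - a * a"
      unfolding ww[symmetric]
      by (simp add: algebra_simps mult_scaleC_left mult_scaleC_right scaleC_scaleC scaleC_minus_left
          scaleC_diff_right scaleC_add_right scaleC_minus_right)
    ultimately show False using z by (simp add: mem_alg_spectrum_iff)
  qed
qed

text \<open>
  The sum \<open>star w * w + w * star w\<close> is half of a sum of two squares of self-adjoint elements. If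
  the first summand is negative, the second is therefore positive; both have the same nonzero spectrum, so
  \<open>star w * w\<close> is positive as well, hence zero.
\<close>
lemma star_mult_self_negative_imp_0:
  fixes w :: "'a::unital_cstar_algebra"
  assumes neg: "- (star w * w) \<in> positive_cone"
  shows "w = 0"
proof -
  define x where "x = w + star w"
  define y where "y = \<i> *\<^sub>C (w - star w)"
  have sa: "star x = x" "star y = y"
    by (simp_all add: x_def y_def star_add star_diff star_star star_scaleC scaleC_minus_left
        scaleC_diff_right)
  have "y * y = - ((w - star w) * (w - star w))"
    by (simp add: y_def mult_scaleC_left mult_scaleC_right scaleC_scaleC scaleC_minus_left)
  then have "w * star w + w * star w = x * x + y * y + (- (star w * w) + - (star w * w))"
    by (simp add: x_def algebra_simps)
  moreover have "x * x + y * y + (- (star w * w) + - (star w * w)) \<in> positive_cone"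
    by (intro positive_cone_add square_self_adjoint_positive sa neg)
  ultimately have "2 *\<^sub>R (w * star w) \<in> positive_cone" by (simp only: scaleR_2)
  from positive_cone_scaleR[OF this, of "1/2"] have p: "w * star w \<in> positive_cone" by simp
  have "star w * w \<in> positive_cone"
    unfolding positive_cone_iff_Re
  proof (intro conjI ballI)
    show "star (star w * w) = star w * w" by (simp add: star_mult star_star)
    fix z assume z: "z \<in> alg_spectrum (star w * w)"
    show "0 \<le> Re z"
    proof (cases "z = 0")
      case False
      then show ?thesis using p spectrum_mult_commute[OF z] by (auto simp: positive_cone_iff_Re)
    qed simp
  qed
  with neg have "star w * w = 0" by (intro positive_cone_pointed)
  then show ?thesis using norm_star_mult_self[of w] by simp
qed

text \<open>
  Write \<open>h = star a * a\<close> and let \<open>s\<close> be the positive square root of \<open>h * h\<close>, so that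
  \<open>u = s + h\<close> and \<open>v = s - h\<close> are twice the positive and the negative part of \<open>h\<close>. Since \<open>u * v = 0\<close>,
  \<open>(u + l) * (v + l) = l * (2 * s + l)\<close> is invertible for every \<open>l > 0\<close>; hence \<open>u\<close> and \<open>v\<close> have
  spectrum in the half line. Then \<open>star (a * v) * (a * v) = v * h * v = - v * v * v / 2\<close> is
  negative, which forces \<open>v = 0\<close>.
\<close>
theorem star_mult_self_positive:
  fixes a :: "'a::unital_cstar_algebra"
  shows "star a * a \<in> positive_cone"
proof -
  define h where "h = star a * a"
  have h: "star h = h" by (simp add: h_def star_mult star_star)
  obtain s where s: "s \<in> positive_cone" "s * s = h * h" "\<And>b. h * h * b = b * (h * h) \<Longrightarrow> s * b = b * s"
    using positive_sqrt[OF square_self_adjoint_positive[OF h]] by blast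
  have sh: "s * h = h * s" by (rule s(3)) (simp add: mult.assoc)
  have ssa: "star s = s" using s(1) by (rule positive_cone_self_adjoint)
  have part: "s + k \<in> positive_cone" if k: "star k = k" "s * k = k * s" "s * s = k * k" for k
    unfolding positive_cone_iff_Re
  proof (intro conjI ballI)
    show sa: "star (s + k) = s + k" by (simp add: star_add ssa k)
    fix z assume z: "z \<in> alg_spectrum (s + k)"
    show "0 \<le> Re z"
    proof (rule ccontr)
      assume neg: "\<not> 0 \<le> Re z"
      define l where "l = - Re z"
      have zl: "z = of_real (- l)" using spectrum_self_adjoint_real[OF sa z] by (simp add: l_def complex_eq_iff)
      have l: "l > 0" using neg by (simp add: l_def)
      have "of_real (- l / 2) \<notin> alg_spectrum s"
        using s(1) l by (force simp: positive_cone_iff_Re)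
      then have inv: "alg_invertible (of_real (- l / 2) *\<^sub>C 1 - s)" by (simp add: mem_alg_spectrum_iff)
      have "(z *\<^sub>C 1 - (s + k)) * (z *\<^sub>C 1 - (s - k)) = of_real (- 2 * l) *\<^sub>C (of_real (- l / 2) *\<^sub>C 1 - s)"
        unfolding zl scaleC_of_real using k
        by (simp add: algebra_simps scaleR_2 flip: scaleR_add_left)
      moreover have "alg_invertible (of_real (- 2 * l) *\<^sub>C (of_real (- l / 2) *\<^sub>C 1 - s))"
        by (rule alg_invertible_scaleC[OF _ inv]) (use l in simp)
      ultimately have "alg_invertible ((z *\<^sub>C 1 - (s + k)) * (z *\<^sub>C 1 - (s - k)))" by simp
      moreover have "(z *\<^sub>C 1 - (s + k)) * (z *\<^sub>C 1 - (s - k)) = (z *\<^sub>C 1 - (s - k)) * (z *\<^sub>C 1 - (s + k))"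
        using k by (simp add: algebra_simps mult_scaleC_left mult_scaleC_right
            scaleC_diff_right scaleC_add_right)
      ultimately have "alg_invertible (z *\<^sub>C 1 - (s + k))" by (rule alg_invertible_factor)
      with z show False by (simp add: mem_alg_spectrum_iff)
    qed
  qed
  define v where "v = s - h"
  have u: "s + h \<in> positive_cone" using h sh s(2) by (intro part)
  have v: "v \<in> positive_cone" using part[of "- h"] h sh s(2) by (simp add: v_def)
  have hv: "h * v = (- 1/2) *\<^sub>R (v * v)"
  proof -
    have "v * v = (- 2) *\<^sub>R (h * v)"
      using sh s(2) by (simp add: v_def algebra_simps scaleR_2)
    then show ?thesis by simp
  qed
  obtain t where t: "t \<in> positive_cone" "t * t = v" using positive_sqrt[OF v] by blast
  have tsa: "star t = t" using t(1) by (rule positive_cone_self_adjoint)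
  have vsa: "star v = v" using v by (rule positive_cone_self_adjoint)
  have "star (a * v) * (a * v) = v * (h * v)"
    by (simp add: star_mult vsa h_def mult.assoc)
  also have "\<dots> = (- 1/2) *\<^sub>R (star (t * t * t) * (t * t * t))"
    unfolding hv by (simp add: star_mult tsa t(2)[symmetric] mult.assoc)
  finally have e: "star (a * v) * (a * v) = (- 1/2) *\<^sub>R (star (t * t * t) * (t * t * t))" .
  have "(t * t * t) * (t * t * t) \<in> positive_cone"
    by (rule square_self_adjoint_positive) (simp add: star_mult tsa mult.assoc)
  then have "star (t * t * t) * (t * t * t) \<in> positive_cone"
    by (simp add: star_mult tsa mult.assoc)
  from positive_cone_scaleR[OF this, of "1/2"]
  have "- (star (a * v) * (a * v)) \<in> positive_cone" unfolding e by simp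
  then have "a * v = 0" by (rule star_mult_self_negative_imp_0)
  with e have "star (t * t * t) * (t * t * t) = 0" by simp
  then have "t * t * t = 0" using norm_star_mult_self[of "t * t * t"] by simp
  then have "v * v = 0" by (metis t(2) mult.assoc mult_zero_right)
  then have "v = 0" using norm_square_self_adjoint[OF vsa] by simp
  then have "h = (1/2) *\<^sub>R (s + h)" by (simp add: v_def scaleR_half_double)
  then show ?thesis using positive_cone_scaleR[OF u, of "1/2"] by (simp add: h_def)
qed

lemma positive_cone_conj:
  fixes p :: "'a::unital_cstar_algebra"
  assumes "p \<in> positive_cone"
  shows "star c * p * c \<in> positive_cone"
proof -
  obtain s where s: "s \<in> positive_cone" "s * s = p" using positive_sqrt[OF assms] by blast
  have "star c * p * c = star (s * c) * (s * c)"
    using positive_cone_self_adjoint[OF s(1)] by (simp add: star_mult s(2)[symmetric] mult.assoc)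
  then show ?thesis using star_mult_self_positive by simp
qed

text \<open>
  For the positivity, write the inverse as \<open>q = star q * p * q\<close>.
\<close>
lemma positive_inverse:
  fixes p :: "'a::unital_cstar_algebra"
  assumes "p - of_real \<epsilon> \<in> positive_cone" "\<epsilon> > 0"
  obtains q where "q * p = 1" "p * q = 1" "q \<in> positive_cone"
proof -
  have "of_real (- \<epsilon>) \<notin> alg_spectrum (p - of_real \<epsilon>)"
    using assms by (force simp: positive_cone_iff_Re)
  then have "alg_invertible p"
    using alg_invertible_minus_iff[of p]
    by (simp add: mem_alg_spectrum_iff scaleC_minus_left scaleC_one_eq_of_real)
  then obtain q where q: "p * q = 1" "q * p = 1" by (auto simp: alg_invertible_def)
  have "p = (p - of_real \<epsilon>) + of_real \<epsilon>" by simp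
  then have p: "p \<in> positive_cone"
    using assms by (metis positive_cone_add positive_cone_of_real less_imp_le)
  have "star q * p = 1" using q(1) positive_cone_self_adjoint[OF p] by (metis star_1 star_mult)
  then have "star q = q" using q by (metis mult.assoc mult_1_left mult_1_right)
  then have "star q * p * q = q" using q by simp
  then have "q \<in> positive_cone" using positive_cone_conj[OF p, of q] by simp
  with q show ?thesis by (intro that)
qed

section \<open>Hermitian forms over the algebra\<close>

text \<open>
  A matrix over the algebra is a function of two indices, of which the values below \<open>n\<close> matter. It
  acts by \<open>app\<close> on the standard Hilbert module of rank \<open>n\<close>, whose inner product takes
  values in the algebra and is conjugate linear in the first argument.
\<close>
definition module_inner :: "nat \<Rightarrow> (nat \<Rightarrow> 'a::unital_cstar_algebra) \<Rightarrow> (nat \<Rightarrow> 'a) \<Rightarrow> 'a" where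
  "module_inner n x y = (\<Sum>i<n. star (x i) * y i)"

definition app :: "nat \<Rightarrow> (nat \<Rightarrow> nat \<Rightarrow> 'a::unital_cstar_algebra) \<Rightarrow> (nat \<Rightarrow> 'a) \<Rightarrow> nat \<Rightarrow> 'a" where
  "app n k x i = (\<Sum>j<n. k i j * x j)"

definition form :: "nat \<Rightarrow> (nat \<Rightarrow> nat \<Rightarrow> 'a::unital_cstar_algebra) \<Rightarrow> (nat \<Rightarrow> 'a) \<Rightarrow> 'a" where
  "form n k x = (\<Sum>i<n. \<Sum>j<n. star (x i) * k i j * x j)"

definition hermitian :: "nat \<Rightarrow> (nat \<Rightarrow> nat \<Rightarrow> 'a::unital_cstar_algebra) \<Rightarrow> bool" where
  "hermitian n k \<longleftrightarrow> (\<forall>i<n. \<forall>j<n. star (k i j) = k j i)"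

text \<open>
  The case \<open>\<epsilon> = 0\<close> is positivity of the form; for \<open>\<epsilon> > 0\<close> the bound
  makes all pivots of Gaussian elimination invertible.
\<close>
definition coercive :: "nat \<Rightarrow> real \<Rightarrow> (nat \<Rightarrow> nat \<Rightarrow> 'a::unital_cstar_algebra) \<Rightarrow> bool" where
  "coercive n \<epsilon> k \<longleftrightarrow> hermitian n k \<and> (\<forall>x. form n k x - \<epsilon> *\<^sub>R module_inner n x x \<in> positive_cone)"

abbreviation positive_form :: "nat \<Rightarrow> (nat \<Rightarrow> nat \<Rightarrow> 'a::unital_cstar_algebra) \<Rightarrow> bool" where
  "positive_form n k \<equiv> coercive n 0 k"

lemma positive_form_iff:
  "positive_form n k \<longleftrightarrow> hermitian n k \<and> (\<forall>x. form n k x \<in> positive_cone)"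
  by (simp add: coercive_def)

lemma hermitianD: "hermitian n k \<Longrightarrow> i < n \<Longrightarrow> j < n \<Longrightarrow> star (k i j) = k j i"
  by (simp add: hermitian_def)

lemma form_eq_inner: "form n k x = module_inner n x (app n k x)"
  by (simp add: form_def module_inner_def app_def sum_distrib_left mult.assoc)

lemma inner_cong:
  "(\<And>i. i < n \<Longrightarrow> x i = x' i) \<Longrightarrow> (\<And>i. i < n \<Longrightarrow> y i = y' i) \<Longrightarrow> module_inner n x y = module_inner n x' y'"
  by (simp add: module_inner_def)

lemma app_cong: "(\<And>j. j < n \<Longrightarrow> x j = y j) \<Longrightarrow> app n k x i = app n k y i"
  by (simp add: app_def)

lemma form_cong:
  "(\<And>i j. i < n \<Longrightarrow> j < n \<Longrightarrow> k i j = l i j) \<Longrightarrow> (\<And>i. i < n \<Longrightarrow> x i = y i) \<Longrightarrow> form n k x = form n l y"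
  by (simp add: form_def)

lemma inner_self_positive: "module_inner n x x \<in> positive_cone"
  unfolding module_inner_def by (intro positive_cone_sum star_mult_self_positive)

lemma inner_app_adjoint:
  assumes "\<And>i j. i < n \<Longrightarrow> j < n \<Longrightarrow> star (l j i) = k i j"
  shows "module_inner n x (app n k y) = module_inner n (app n l x) y"
proof -
  have "module_inner n x (app n k y) = (\<Sum>i<n. \<Sum>j<n. star (x i) * k i j * y j)"
    by (simp add: module_inner_def app_def sum_distrib_left mult.assoc)
  also have "\<dots> = (\<Sum>j<n. \<Sum>i<n. star (x i) * k i j * y j)" by (rule sum.swap)
  also have "\<dots> = module_inner n (app n l x) y"
    unfolding module_inner_def app_def star_sum sum_distrib_right star_mult
    by (intro sum.cong refl) (simp add: assms)
  finally show ?thesis .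
qed

lemma inner_app_hermitian:
  "hermitian n k \<Longrightarrow> module_inner n x (app n k y) = module_inner n (app n k x) y"
  by (rule inner_app_adjoint) (rule hermitianD)

lemma inner_diff_right: "module_inner n x (\<lambda>i. y i - z i) = module_inner n x y - module_inner n x z"
  by (simp add: module_inner_def right_diff_distrib sum_subtractf)

lemma inner_diff_left: "module_inner n (\<lambda>i. y i - z i) x = module_inner n y x - module_inner n z x"
  by (simp add: module_inner_def left_diff_distrib star_diff sum_subtractf)

lemma inner_scaleR_right: "module_inner n x (\<lambda>i. r *\<^sub>R y i) = r *\<^sub>R module_inner n x y"
  by (simp add: module_inner_def scaleR_sum_right)

lemma inner_scaleR_left: "module_inner n (\<lambda>i. r *\<^sub>R x i) y = r *\<^sub>R module_inner n x y"
  by (simp add: module_inner_def scaleR_sum_right star_scaleR)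

lemma inner_scaleC_right: "module_inner n x (\<lambda>i. c *\<^sub>C y i) = c *\<^sub>C module_inner n x y"
  by (induction n) (simp_all add: module_inner_def scaleC_add_right mult_scaleC_right)

lemma inner_scaleC_left: "module_inner n (\<lambda>i. c *\<^sub>C x i) y = cnj c *\<^sub>C module_inner n x y"
  by (induction n) (simp_all add: module_inner_def scaleC_add_right mult_scaleC_left star_scaleC)

lemma app_diff: "app n k (\<lambda>i. x i - y i) i = app n k x i - app n k y i"
  by (simp add: app_def right_diff_distrib sum_subtractf)

lemma app_scaleR: "app n k (\<lambda>i. r *\<^sub>R x i) i = r *\<^sub>R app n k x i"
  by (simp add: app_def scaleR_sum_right)

lemma coercive_mono:
  assumes "coercive n \<epsilon> k" "\<delta> \<le> \<epsilon>"
  shows "coercive n \<delta> k"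
proof -
  have "form n k x - \<delta> *\<^sub>R module_inner n x x \<in> positive_cone" for x
  proof -
    have "(form n k x - \<epsilon> *\<^sub>R module_inner n x x) + (\<epsilon> - \<delta>) *\<^sub>R module_inner n x x \<in> positive_cone"
      using assms unfolding coercive_def
      by (intro positive_cone_add positive_cone_scaleR inner_self_positive) auto
    then show ?thesis by (simp add: scaleR_diff_left)
  qed
  then show ?thesis using assms(1) by (simp add: coercive_def)
qed

section \<open>Schur complements\<close>

text \<open>
  The argument \<open>q\<close> stands for the inverse of the pivot \<open>k n n\<close>.
\<close>
definition schur_compl :: "nat \<Rightarrow> 'a::unital_cstar_algebra \<Rightarrow> (nat \<Rightarrow> nat \<Rightarrow> 'a) \<Rightarrow> nat \<Rightarrow> nat \<Rightarrow> 'a" where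
  "schur_compl n q k i j = k i j - k i n * q * k n j"

text \<open>
  Completing the square in the last coordinate.
\<close>
lemma form_Suc_schur_compl:
  fixes x :: "nat \<Rightarrow> 'a::unital_cstar_algebra"
  assumes k: "hermitian (Suc n) k" and q: "q * k n n = 1" "k n n * q = 1" "star q = q"
  defines "y \<equiv> app n k x n"
  shows "form (Suc n) k x
    = form n (schur_compl n q k) x + star (x n + q * y) * k n n * (x n + q * y)"
proof -
  have sy: "star y = (\<Sum>i<n. star (x i) * k i n)"
    by (simp add: y_def app_def star_sum star_mult hermitianD[OF k])
  have "form (Suc n) k x = form n k x + star y * x n + star (x n) * y + star (x n) * k n n * x n"
    unfolding sy unfolding y_def app_def
    by (simp add: form_def sum.distrib sum_distrib_right sum_distrib_left mult.assoc add.assoc)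
  moreover have "form n (schur_compl n q k) x = form n k x - star y * q * y"
  proof -
    have "star y * q * y = (\<Sum>i<n. \<Sum>j<n. star (x i) * (k i n * q * k n j) * x j)"
      unfolding sy unfolding y_def app_def
      by (simp add: sum_distrib_right sum_distrib_left mult.assoc) (rule sum.swap)
    then show ?thesis
      by (simp add: form_def schur_compl_def right_diff_distrib left_diff_distrib sum_subtractf)
  qed
  moreover have "star (x n + q * y) * k n n * (x n + q * y)
      = star (x n) * k n n * x n + star (x n) * y + star y * x n + star y * q * y"
  proof -
    have "star (x n + q * y) * k n n * (x n + q * y)
      = star (x n) * k n n * x n + star (x n) * (k n n * q) * y + star y * (q * k n n) * x n
        + star y * q * (k n n * q) * y"
      by (simp add: star_add star_mult q(3) distrib_left distrib_right mult.assoc)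
    then show ?thesis by (simp add: q)
  qed
  ultimately show ?thesis by simp
qed

text \<open>
  The bound at the last unit vector makes \<open>k n n\<close> invertible. Choosing the last coordinate so that
  the completed square vanishes shows that the Schur complement inherits the bound.
\<close>
lemma coercive_pivot:
  assumes "coercive (Suc n) \<epsilon> k" "\<epsilon> > 0"
  obtains q where "q * k n n = 1" "k n n * q = 1" "q \<in> positive_cone"
    "coercive n \<epsilon> (schur_compl n q k)"
proof -
  have k: "hermitian (Suc n) k" using assms by (simp add: coercive_def)
  define e where "e i = (if i = n then 1 else 0 :: 'a)" for i
  have "form (Suc n) k e = k n n" "module_inner (Suc n) e e = 1"
    by (simp_all add: form_def module_inner_def e_def)
  then have "k n n - of_real \<epsilon> \<in> positive_cone"
    using assms(1) by (metis coercive_def of_real_def)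
  then obtain q where q: "q * k n n = 1" "k n n * q = 1" "q \<in> positive_cone"
    using positive_inverse assms(2) by blast
  have sq: "star q = q" using q(3) by (rule positive_cone_self_adjoint)
  have "coercive n \<epsilon> (schur_compl n q k)"
    unfolding coercive_def
  proof (intro conjI allI)
    show "hermitian n (schur_compl n q k)"
      using k by (simp add: hermitian_def schur_compl_def star_diff star_mult sq mult.assoc)
    fix x
    define x' where "x' = x(n := - q * app n k x n)"
    have a: "app n k x' n = app n k x n" by (rule app_cong) (simp add: x'_def)
    have b: "form n (schur_compl n q k) x' = form n (schur_compl n q k) x"
      by (rule form_cong) (simp_all add: x'_def)
    have "form (Suc n) k x' = form n (schur_compl n q k) x"
      unfolding form_Suc_schur_compl[OF k q(1,2) sq] a b by (simp add: x'_def)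
    moreover have "module_inner (Suc n) x' x' = module_inner n x x + star (x' n) * x' n"
      by (simp add: module_inner_def x'_def)
    moreover have "form (Suc n) k x' - \<epsilon> *\<^sub>R module_inner (Suc n) x' x' \<in> positive_cone"
      using assms(1) by (simp add: coercive_def)
    moreover have "\<epsilon> *\<^sub>R (star (x' n) * x' n) \<in> positive_cone"
      using assms(2) by (intro positive_cone_scaleR star_mult_self_positive) simp
    ultimately have "(form n (schur_compl n q k) x - \<epsilon> *\<^sub>R (module_inner n x x + star (x' n) * x' n))
        + \<epsilon> *\<^sub>R (star (x' n) * x' n) \<in> positive_cone"
      by (intro positive_cone_add) simp_all
    then show "form n (schur_compl n q k) x - \<epsilon> *\<^sub>R module_inner n x x \<in> positive_cone"
      by (simp add: scaleR_add_right)
  qed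
  with q show ?thesis by (intro that)
qed

text \<open>
  Gaussian elimination, with the pivots supplied by \<open>coercive_pivot\<close>.
\<close>
lemma coercive_solvable:
  assumes "coercive n \<epsilon> k" "\<epsilon> > 0"
  shows "\<exists>x. \<forall>i<n. app n k x i = v i"
  using assms(1)
proof (induction n arbitrary: k v)
  case (Suc n)
  obtain q where q: "q * k n n = 1" "k n n * q = 1" "coercive n \<epsilon> (schur_compl n q k)"
    using coercive_pivot[OF Suc.prems assms(2)] by metis
  obtain x where x: "\<And>i. i < n \<Longrightarrow> app n (schur_compl n q k) x i = v i - k i n * q * v n"
    using Suc.IH[OF q(3), of "\<lambda>i. v i - k i n * q * v n"] by auto
  define y where "y = x(n := q * (v n - app n k x n))"
  have app_y: "app (Suc n) k y i = app n k x i + k i n * q * (v n - app n k x n)" for i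
    by (simp add: app_def y_def mult.assoc)
  have "app (Suc n) k y i = v i" if "i < Suc n" for i
  proof (cases "i = n")
    case True
    then show ?thesis by (simp add: app_y q(2))
  next
    case False
    have "app n (schur_compl n q k) x i = app n k x i - k i n * q * app n k x n"
      by (simp add: app_def schur_compl_def left_diff_distrib sum_subtractf sum_distrib_left mult.assoc)
    with x[of i] False that show ?thesis by (simp add: app_y right_diff_distrib algebra_simps)
  qed
  then show ?case by blast
qed simp

section \<open>Norm bounds and shifts of forms\<close>

text \<open>
  Two inequalities of Cauchy-Schwarz type give this:
  \<open>\<bar>\<Sum>j<n. u j\<bar>\<^sup>2 \<le> n * (\<Sum>j<n. \<bar>u j\<bar>\<^sup>2)\<close> and
  \<open>\<bar>b * y\<bar>\<^sup>2 \<le> (norm b)\<^sup>2 * \<bar>y\<bar>\<^sup>2\<close>, where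
  \<open>\<bar>u\<bar>\<^sup>2\<close> stands for \<open>star u * u\<close>.
\<close>
lemma inner_app_bound:
  fixes B :: "nat \<Rightarrow> nat \<Rightarrow> 'a::unital_cstar_algebra"
  shows "\<exists>C>0. \<forall>x. C *\<^sub>R module_inner n x x - module_inner n (app n B x) (app n B x) \<in> positive_cone"
proof -
  have cs: "real m *\<^sub>R (\<Sum>j<m. star (u j) * u j) - star (\<Sum>j<m. u j) * (\<Sum>j<m. u j) \<in> positive_cone"
    for m and u :: "nat \<Rightarrow> 'a"
  proof (induction m)
    case (Suc m)
    define s where "s = (\<Sum>j<m. u j)"
    have "(\<Sum>j<m. star (u j - u m) * (u j - u m))
        = (\<Sum>j<m. star (u j) * u j) - star s * u m - star (u m) * s + real m *\<^sub>R (star (u m) * u m)"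
      by (simp add: star_diff left_diff_distrib right_diff_distrib sum_subtractf sum.distrib s_def
          star_sum sum_distrib_left sum_distrib_right scaleR_conv_of_real)
    then have "real (Suc m) *\<^sub>R (\<Sum>j<Suc m. star (u j) * u j) - star (\<Sum>j<Suc m. u j) * (\<Sum>j<Suc m. u j)
        = (real m *\<^sub>R (\<Sum>j<m. star (u j) * u j) - star s * s)
          + (\<Sum>j<m. star (u j - u m) * (u j - u m))"
      by (simp add: s_def[symmetric] star_add distrib_left distrib_right scaleR_add_left scaleR_add_right)
    then show ?case
      using Suc by (simp add: s_def positive_cone_add positive_cone_sum star_mult_self_positive)
  qed simp
  define C where "C = 1 + (\<Sum>i<n. \<Sum>j<n. real n * (norm (B i j))\<^sup>2)"
  show ?thesis
  proof (intro exI[of _ C] conjI allI)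
    show "C > 0" by (simp add: C_def sum_nonneg add_pos_nonneg)
    fix x
    have "star (B i j) * B i j \<in> positive_cone \<and> of_real ((norm (B i j))\<^sup>2) - star (B i j) * B i j \<in> positive_cone" for i j
      using norm_star_mult_self[of "B i j"]
      by (auto intro!: star_mult_self_positive self_adjoint_le_norm simp: star_mult star_star simp del: of_real_power)
    then have "star (x j) * (of_real ((norm (B i j))\<^sup>2) - star (B i j) * B i j) * x j \<in> positive_cone" for i j
      by (intro positive_cone_conj) simp
    then have 1: "(norm (B i j))\<^sup>2 *\<^sub>R (star (x j) * x j) - star (B i j * x j) * (B i j * x j) \<in> positive_cone" for i j
      by (simp add: star_mult left_diff_distrib right_diff_distrib of_real_mult_right mult.assoc del: of_real_power)
    have 2: "module_inner n x x - star (x j) * x j \<in> positive_cone" if "j < n" for j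
    proof -
      have "module_inner n x x - star (x j) * x j = (\<Sum>i\<in>{..<n} - {j}. star (x i) * x i)"
        using that by (simp add: module_inner_def sum_diff1)
      then show ?thesis by (simp add: positive_cone_sum star_mult_self_positive)
    qed
    have 3: "(norm (B i j))\<^sup>2 *\<^sub>R module_inner n x x - star (B i j * x j) * (B i j * x j) \<in> positive_cone" if "j < n" for i j
    proof -
      have "(norm (B i j))\<^sup>2 *\<^sub>R module_inner n x x - star (B i j * x j) * (B i j * x j)
        = (norm (B i j))\<^sup>2 *\<^sub>R (module_inner n x x - star (x j) * x j)
          + ((norm (B i j))\<^sup>2 *\<^sub>R (star (x j) * x j) - star (B i j * x j) * (B i j * x j))"
        by (simp add: scaleR_diff_right)
      also have "\<dots> \<in> positive_cone"
        by (intro positive_cone_add positive_cone_scaleR 1 2[OF that]) simp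
      finally show ?thesis .
    qed
    define D where "D i = real n *\<^sub>R (\<Sum>j<n. star (B i j * x j) * (B i j * x j))
      - star (app n B x i) * app n B x i" for i
    define E where "E i j = real n *\<^sub>R ((norm (B i j))\<^sup>2 *\<^sub>R module_inner n x x - star (B i j * x j) * (B i j * x j))" for i j
    have "C *\<^sub>R module_inner n x x - module_inner n (app n B x) (app n B x)
        = module_inner n x x + (\<Sum>i<n. (\<Sum>j<n. E i j) + D i)"
      unfolding C_def D_def E_def module_inner_def[of n "app n B x"]
      by (simp add: scaleR_add_left scaleR_sum_left scaleR_sum_right scaleR_diff_right sum.distrib sum_subtractf)
    moreover have "module_inner n x x + (\<Sum>i<n. (\<Sum>j<n. E i j) + D i) \<in> positive_cone"
      unfolding D_def E_def app_def
      by (intro positive_cone_add positive_cone_sum positive_cone_scaleR cs 3 inner_self_positive) auto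
    ultimately show "C *\<^sub>R module_inner n x x - module_inner n (app n B x) (app n B x) \<in> positive_cone" by simp
  qed
qed

text \<open>
  Positivity of the inner squares of \<open>x + k x\<close> and \<open>x - k x\<close>, together with the bound
  for \<open>k x\<close>.
\<close>
lemma form_bound:
  assumes "hermitian n k"
  shows "\<exists>C>0. \<forall>x. C *\<^sub>R module_inner n x x - form n k x \<in> positive_cone \<and>
    C *\<^sub>R module_inner n x x + form n k x \<in> positive_cone"
proof -
  obtain C where C: "C > 0" "\<And>x. C *\<^sub>R module_inner n x x - module_inner n (app n k x) (app n k x) \<in> positive_cone"
    using inner_app_bound[of n k] by blast
  have pos: "(C + 1) *\<^sub>R module_inner n x x + r *\<^sub>R form n k x \<in> positive_cone"
    if r: "r = 2 \<or> r = - 2" for x and r :: real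
  proof -
    define y where "y i = x i - (- (r / 2)) *\<^sub>R app n k x i" for i
    have s: "module_inner n (app n k x) x = form n k x"
      using inner_app_hermitian[OF assms, of x x] by (simp add: form_eq_inner)
    have rr: "(r / 2) * (r / 2) = 1" using r by auto
    have "module_inner n y y = module_inner n x x + r *\<^sub>R form n k x + module_inner n (app n k x) (app n k x)"
      unfolding y_def inner_diff_left inner_diff_right inner_scaleR_left inner_scaleR_right s
        form_eq_inner[symmetric] using rr
      by (simp add: algebra_simps flip: scaleR_add_left)
    then have "(C + 1) *\<^sub>R module_inner n x x + r *\<^sub>R form n k x
        = module_inner n y y + (C *\<^sub>R module_inner n x x - module_inner n (app n k x) (app n k x))"
      by (simp add: scaleR_add_left)
    then show ?thesis using C(2) by (simp add: positive_cone_add inner_self_positive)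
  qed
  show ?thesis
  proof (intro exI[of _ "(C + 1) / 2"] conjI allI)
    show "(C + 1) / 2 > 0" using C(1) by simp
    fix x
    show "((C + 1) / 2) *\<^sub>R module_inner n x x - form n k x \<in> positive_cone"
      using positive_cone_scaleR[OF pos[of "-2" x], of "1/2"] by (simp add: scaleR_diff_right)
    show "((C + 1) / 2) *\<^sub>R module_inner n x x + form n k x \<in> positive_cone"
      using positive_cone_scaleR[OF pos[of 2 x], of "1/2"] by (simp add: scaleR_add_right)
  qed
qed

text \<open>
  With \<open>T \<le> c\<close>, the identity \<open>c * T * (c - T) = T * (c - T) * T + (c - T) * T * (c - T)\<close> gives
  \<open>T * T \<le> c * T\<close>; a left inverse bounds \<open>T * T\<close> from below.
\<close>
lemma positive_form_left_inverse_coercive: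
  assumes T: "positive_form n T"
    and B: "\<And>x i. i < n \<Longrightarrow> app n B (app n T x) i = x i"
  obtains \<delta> where "\<delta> > 0" "coercive n \<delta> T"
proof -
  have h: "hermitian n T" using T by (simp add: coercive_def)
  obtain c where c: "c > 0" "\<And>x. c *\<^sub>R module_inner n x x - form n T x \<in> positive_cone"
    using form_bound[OF h] by blast
  obtain C where C: "C > 0" "\<And>x. C *\<^sub>R module_inner n x x - module_inner n (app n B x) (app n B x) \<in> positive_cone"
    using inner_app_bound[of n B] by blast
  have sq: "c *\<^sub>R form n T x - module_inner n (app n T x) (app n T x) \<in> positive_cone" for x
  proof -
    define y where "y i = c *\<^sub>R x i - app n T x i" for i
    have Ty: "app n T y i = c *\<^sub>R app n T x i - app n T (app n T x) i" for i
      unfolding y_def app_diff app_scaleR ..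
    have s: "module_inner n (app n T x) x = form n T x"
      using inner_app_hermitian[OF h, of x x] by (simp add: form_eq_inner)
    have s2: "module_inner n x (app n T (app n T x)) = module_inner n (app n T x) (app n T x)"
      by (rule inner_app_hermitian[OF h])
    have "form n T y = (c * c) *\<^sub>R form n T x - (2 * c) *\<^sub>R module_inner n (app n T x) (app n T x) + form n T (app n T x)"
      unfolding form_eq_inner[of n T y] Ty[abs_def]
      unfolding y_def inner_diff_left inner_diff_right inner_scaleR_left inner_scaleR_right s2
      by (simp add: form_eq_inner algebra_simps flip: scaleR_add_left)
    then have "c *\<^sub>R (c *\<^sub>R form n T x - module_inner n (app n T x) (app n T x))
        = (c *\<^sub>R module_inner n (app n T x) (app n T x) - form n T (app n T x)) + form n T y"
      by (simp add: algebra_simps flip: scaleR_add_left)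
    moreover have "form n T y \<in> positive_cone" using T by (simp add: positive_form_iff)
    ultimately have "c *\<^sub>R (c *\<^sub>R form n T x - module_inner n (app n T x) (app n T x)) \<in> positive_cone"
      using c(2) by (simp add: positive_cone_add)
    from positive_cone_scaleR[OF this, of "inverse c"] c(1) show ?thesis by simp
  qed
  show ?thesis
  proof (rule that[of "1 / (C * c)"])
    show "1 / (C * c) > 0" using C c by simp
    show "coercive n (1 / (C * c)) T"
      unfolding coercive_def
    proof (intro conjI allI h)
      fix x
      have "module_inner n (app n B (app n T x)) (app n B (app n T x)) = module_inner n x x"
        using B by (intro inner_cong) auto
      with C(2)[of "app n T x"]
      have 1: "C *\<^sub>R module_inner n (app n T x) (app n T x) - module_inner n x x \<in> positive_cone" by simp
      have "form n T x - (1 / (C * c)) *\<^sub>R module_inner n x x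
          = (1 / c) *\<^sub>R (c *\<^sub>R form n T x - module_inner n (app n T x) (app n T x))
          + (1 / (C * c)) *\<^sub>R (C *\<^sub>R module_inner n (app n T x) (app n T x) - module_inner n x x)"
        using C(1) c(1) by (simp add: scaleR_diff_right)
      then show "form n T x - (1 / (C * c)) *\<^sub>R module_inner n x x \<in> positive_cone"
        using sq 1 C(1) c(1) by (simp add: positive_cone_add positive_cone_scaleR)
    qed
  qed
qed

definition shift :: "real \<Rightarrow> (nat \<Rightarrow> nat \<Rightarrow> 'a::unital_cstar_algebra) \<Rightarrow> nat \<Rightarrow> nat \<Rightarrow> 'a" where
  "shift s k i j = k i j + (if i = j then of_real s else 0)"

lemma app_shift: "i < n \<Longrightarrow> app n (shift s k) x i = app n k x i + s *\<^sub>R x i"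
  by (simp add: app_def shift_def distrib_right sum.distrib if_distrib[of "\<lambda>u. u * _"]
        of_real_mult_left cong: if_cong)

lemma form_shift: "form n (shift s k) x = form n k x + s *\<^sub>R module_inner n x x"
  by (simp add: form_eq_inner module_inner_def app_shift distrib_left sum.distrib scaleR_sum_right)

lemma hermitian_shift: "hermitian n k \<Longrightarrow> hermitian n (shift s k)"
  by (simp add: hermitian_def shift_def star_add)

lemma coercive_shift: "positive_form n k \<Longrightarrow> coercive n s (shift s k)"
  by (simp add: coercive_def form_shift hermitian_shift)

text \<open>
  This turns the spectral condition into an inequality. Let \<open>s0\<close> be the least
  \<open>s \<ge> 0\<close> for which \<open>k + s\<close> has a positive form. If \<open>s0 > 0\<close>, then
  \<open>k + s0\<close> is also invertible, hence coercive by
  \<open>positive_form_left_inverse_coercive\<close>, and a smaller shift would do.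
\<close>
lemma positive_form_of_invertible_shifts:
  assumes h: "hermitian n k"
    and B: "\<And>s x i. s > 0 \<Longrightarrow> i < n \<Longrightarrow> app n (B s) (\<lambda>j. app n k x j + s *\<^sub>R x j) i = x i"
  shows "positive_form n k"
proof -
  define S where "S = {s. s \<ge> 0 \<and> (\<forall>x. form n k x + s *\<^sub>R module_inner n x x \<in> positive_cone)}"
  obtain C where "C > 0" "\<And>x. C *\<^sub>R module_inner n x x + form n k x \<in> positive_cone"
    using form_bound[OF h] by blast
  then have "C \<in> S" by (simp add: S_def add.commute)
  have bdd: "bdd_below S" by (rule bdd_belowI[of _ 0]) (simp add: S_def)
  have up: "t \<in> S" if "s \<in> S" "s \<le> t" for s t
  proof -
    have "(form n k x + s *\<^sub>R module_inner n x x) + (t - s) *\<^sub>R module_inner n x x \<in> positive_cone" for x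
      using that unfolding S_def
      by (intro positive_cone_add[of "_ + _"] positive_cone_scaleR inner_self_positive) auto
    then have "form n k x + t *\<^sub>R module_inner n x x \<in> positive_cone" for x
      by (simp add: scaleR_diff_left)
    then show ?thesis using that by (simp add: S_def)
  qed
  define s0 where "s0 = Inf S"
  have s0: "s0 \<ge> 0" unfolding s0_def by (rule cInf_greatest) (use \<open>C \<in> S\<close> in \<open>auto simp: S_def\<close>)
  have s0S: "s0 \<in> S"
  proof -
    have *: "s0 + inverse (real (Suc m)) \<in> S" for m
    proof -
      have "Inf S < s0 + inverse (real (Suc m))" by (simp add: s0_def)
      then obtain s where "s \<in> S" "s < s0 + inverse (real (Suc m))"
        using cInf_lessD[of S] \<open>C \<in> S\<close> by blast
      then show ?thesis using up by simp
    qed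
    have "form n k x + s0 *\<^sub>R module_inner n x x \<in> positive_cone" for x
    proof (rule positive_cone_limit)
      show "form n k x + (s0 + inverse (real (Suc m))) *\<^sub>R module_inner n x x \<in> positive_cone" for m
        using * by (simp add: S_def)
      have "(\<lambda>m. form n k x + (s0 + inverse (real (Suc m))) *\<^sub>R module_inner n x x)
          \<longlonglongrightarrow> form n k x + (s0 + 0) *\<^sub>R module_inner n x x"
        by (intro tendsto_intros LIMSEQ_inverse_real_of_nat)
      then show "(\<lambda>m. form n k x + (s0 + inverse (real (Suc m))) *\<^sub>R module_inner n x x)
          \<longlonglongrightarrow> form n k x + s0 *\<^sub>R module_inner n x x" by simp
    qed
    with s0 show ?thesis by (simp add: S_def)
  qed
  have "s0 = 0"
  proof (rule ccontr)
    assume "s0 \<noteq> 0"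
    with s0 have pos: "s0 > 0" by simp
    have "positive_form n (shift s0 k)"
      using s0S hermitian_shift[OF h] by (simp add: positive_form_iff form_shift S_def)
    moreover have "app n (B s0) (app n (shift s0 k) x) i = x i" if "i < n" for x i
    proof -
      have "app n (B s0) (app n (shift s0 k) x) i = app n (B s0) (\<lambda>j. app n k x j + s0 *\<^sub>R x j) i"
        by (rule app_cong) (rule app_shift)
      then show ?thesis using B[OF pos that] by simp
    qed
    ultimately obtain \<delta> where \<delta>: "\<delta> > 0" "coercive n \<delta> (shift s0 k)"
      by (rule positive_form_left_inverse_coercive)
    define d where "d = min \<delta> s0"
    have "coercive n d (shift s0 k)" by (rule coercive_mono[OF \<delta>(2)]) (simp add: d_def)
    then have "s0 - d \<in> S"
      by (auto simp: S_def coercive_def form_shift d_def scaleR_diff_left algebra_simps)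
    then have "s0 \<le> s0 - d" unfolding s0_def using bdd by (intro cInf_lower)
    then show False using \<delta>(1) pos by (simp add: d_def)
  qed
  then show ?thesis using s0S h by (simp add: positive_form_iff S_def)
qed

section \<open>Positive matrices are the matrices of positive forms\<close>

text \<open>
  The operator \<open>N = (z - k) * (cnj z - k)\<close> has the form
  \<open>\<bar>(cnj z - k) x\<bar>\<^sup>2\<close>. It is coercive: for \<open>Re z \<le> 0\<close> expand it
  and drop the terms \<open>- 2 * Re z * form k\<close> and \<open>\<bar>k x\<bar>\<^sup>2\<close>; otherwise it
  equals \<open>\<bar>(Re z - k) x\<bar>\<^sup>2 + (Im z)\<^sup>2 * \<bar>x\<bar>\<^sup>2\<close> and
  \<open>Im z\<close> is nonzero. So \<open>N\<close> has a right inverse, and so has \<open>z - k\<close>.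
\<close>
lemma positive_form_resolvent_solvable:
  fixes k :: "nat \<Rightarrow> nat \<Rightarrow> 'a::unital_cstar_algebra"
  assumes k: "positive_form n k" and z: "z \<notin> \<real>\<^sub>\<ge>\<^sub>0"
  shows "\<exists>x. \<forall>i<n. z *\<^sub>C x i - app n k x i = v i"
proof -
  have h: "hermitian n k" using k by (simp add: coercive_def)
  define r where "r w i j = (if i = j then w *\<^sub>C 1 else 0) - k i j" for w i j
  have app_r: "app n (r w) x i = w *\<^sub>C x i - app n k x i" if "i < n" for w x i
    using that by (simp add: app_def r_def left_diff_distrib sum_subtractf if_distrib[of "\<lambda>u. u * _"]
        mult_scaleC_left cong: if_cong)
  define N where "N i j = (\<Sum>l<n. r z i l * r (cnj z) l j)" for i j
  have star_r: "star (r w j i) = r (cnj w) i j" if "i < n" "j < n" for w i j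
    using that by (simp add: r_def star_diff star_scaleC hermitianD[OF h])
  have app_N: "app n N x i = app n (r z) (app n (r (cnj z)) x) i" for x i
    unfolding app_def N_def sum_distrib_left sum_distrib_right
    by (subst sum.swap) (simp add: mult.assoc)
  have hN: "hermitian n N"
    by (simp add: hermitian_def N_def star_sum star_mult star_r)
  have form_N: "form n N x = module_inner n (app n (r (cnj z)) x) (app n (r (cnj z)) x)" for x
  proof -
    have "form n N x = module_inner n x (app n (r z) (app n (r (cnj z)) x))"
      by (simp add: form_eq_inner app_N[abs_def])
    also have "\<dots> = module_inner n (app n (r (cnj z)) x) (app n (r (cnj z)) x)"
      by (rule inner_app_adjoint) (simp add: star_r)
    finally show ?thesis .
  qed
  define \<epsilon> where "\<epsilon> = (if Re z \<le> 0 then (cmod z)\<^sup>2 else (Im z)\<^sup>2)"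
  have \<epsilon>: "\<epsilon> > 0" using z by (auto simp: \<epsilon>_def complex_nonneg_Reals_iff)
  have "form n N x - \<epsilon> *\<^sub>R module_inner n x x \<in> positive_cone" for x
  proof -
    have s: "module_inner n (app n k x) x = form n k x"
      using inner_app_hermitian[OF h, of x x] by (simp add: form_eq_inner)
    have "form n N x = module_inner n (\<lambda>i. cnj z *\<^sub>C x i - app n k x i) (\<lambda>i. cnj z *\<^sub>C x i - app n k x i)"
      unfolding form_N by (intro inner_cong) (simp_all add: app_r)
    also have "\<dots> = (z * cnj z) *\<^sub>C module_inner n x x - (z + cnj z) *\<^sub>C form n k x
        + module_inner n (app n k x) (app n k x)"
      unfolding inner_diff_left inner_diff_right inner_scaleC_left inner_scaleC_right s
        form_eq_inner[symmetric]
      by (simp add: scaleC_scaleC scaleC_add_left mult.commute)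
    also have "\<dots> = (cmod z)\<^sup>2 *\<^sub>R module_inner n x x - (2 * Re z) *\<^sub>R form n k x
        + module_inner n (app n k x) (app n k x)"
      by (simp only: complex_norm_square[symmetric] complex_add_cnj scaleC_of_real)
    finally have N: "form n N x = \<dots>" .
    show ?thesis
    proof (cases "Re z \<le> 0")
      case True
      have "(- (2 * Re z)) *\<^sub>R form n k x + module_inner n (app n k x) (app n k x) \<in> positive_cone"
        using True k by (intro positive_cone_add positive_cone_scaleR inner_self_positive)
          (auto simp: positive_form_iff)
      then show ?thesis using True by (simp add: N \<epsilon>_def)
    next
      case False
      define y where "y i = Re z *\<^sub>R x i - app n k x i" for i
      have "module_inner n y y = (Re z * Re z) *\<^sub>R module_inner n x x - (2 * Re z) *\<^sub>R form n k x
        + module_inner n (app n k x) (app n k x)"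
        unfolding y_def inner_diff_left inner_diff_right inner_scaleR_left inner_scaleR_right s
          form_eq_inner[symmetric]
        by (simp add: algebra_simps flip: scaleR_add_left)
      then have "form n N x - \<epsilon> *\<^sub>R module_inner n x x = module_inner n y y"
        using False unfolding N \<epsilon>_def cmod_power2
        by (simp add: power2_eq_square scaleR_add_left)
      then show ?thesis by (simp add: inner_self_positive)
    qed
  qed
  then have "coercive n \<epsilon> N" using hN by (simp add: coercive_def)
  then obtain x where x: "\<And>i. i < n \<Longrightarrow> app n N x i = v i"
    using coercive_solvable[OF _ \<epsilon>, of n N v] by blast
  show ?thesis
    by (rule exI[of _ "app n (r (cnj z)) x"]) (simp add: x[symmetric] app_N app_r)
qed

text \<open>
  The bridge between the spectral definition of positivity in the matrix algebra and the order of the algebra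
  itself, for entries that need not commute.
\<close>
theorem mat_positive_iff_positive_form:
  fixes k :: "nat \<Rightarrow> nat \<Rightarrow> 'a::unital_cstar_algebra"
  shows "mat_positive n (Matrix.mat n n (\<lambda>(i, j). k i j)) \<longleftrightarrow> positive_form n k"
proof -
  let ?M = "Matrix.mat n n (\<lambda>(i, j). k i j)"
  define A where "A w = (w *\<^sub>C 1) \<cdot>\<^sub>m 1\<^sub>m n - ?M" for w
  have A: "A w \<in> carrier_mat n n" for w by (auto simp: A_def)
  have A_ix: "A w $$ (i, j) = (if i = j then w *\<^sub>C 1 else 0) - k i j" if "i < n" "j < n" for w i j
    using that by (simp add: A_def)
  have spec: "w \<in> mat_spectrum ?M \<longleftrightarrow> \<not> invertible_mat (A w)" for w
    by (simp add: mat_spectrum_def A_def)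
  have mult_ix: "(B * C) $$ (i, j) = (\<Sum>l<n. B $$ (i, l) * C $$ (l, j))"
    if "B \<in> carrier_mat n n" "C \<in> carrier_mat n n" "i < n" "j < n" for B C :: "'a mat" and i j
    using that by (auto simp: scalar_prod_def atLeast0LessThan intro!: sum.cong)
  have star_M: "mat_star ?M = ?M \<longleftrightarrow> hermitian n k"
  proof
    assume e: "mat_star ?M = ?M"
    show "hermitian n k"
      unfolding hermitian_def
    proof (intro allI impI)
      fix i j assume "i < n" "j < n"
      then show "star (k i j) = k j i"
        using arg_cong[OF e, of "\<lambda>N. N $$ (j, i)"] by (simp add: mat_star_def)
    qed
  next
    assume "hermitian n k"
    then show "mat_star ?M = ?M" by (intro eq_matI) (auto simp: mat_star_def hermitian_def)
  qed
  show ?thesis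
  proof
    assume pos: "mat_positive n ?M"
    then have h: "hermitian n k" using star_M by (simp add: mat_positive_def)
    have "\<exists>B. \<forall>x. \<forall>i<n. app n B (\<lambda>j. app n k x j + s *\<^sub>R x j) i = x i" if s: "s > 0" for s
    proof -
      have "complex_of_real (- s) \<notin> mat_spectrum ?M"
        using pos s by (auto simp: mat_positive_def complex_nonneg_Reals_iff)
      then obtain B where "inverts_mat B (A (of_real (- s)))" "inverts_mat (A (of_real (- s))) B"
        by (auto simp: spec invertible_mat_def)
      then have BA: "B * A (of_real (- s)) = 1\<^sub>m (dim_row B)" "A (of_real (- s)) * B = 1\<^sub>m n"
        using A[of "of_real (- s)"] by (auto simp: inverts_mat_def)
      have B: "B \<in> carrier_mat n n"
        using arg_cong[OF BA(1), of dim_col] arg_cong[OF BA(2), of dim_col] A[of "of_real (- s)"] by auto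
      have ix: "(\<Sum>l<n. B $$ (i, l) * A (of_real (- s)) $$ (l, j)) = (if i = j then 1 else 0)"
        if "i < n" "j < n" for i j
        using mult_ix[OF B A that] BA(1) B that by (metis carrier_matD(1) index_one_mat(1))
      have "app n (\<lambda>i l. - B $$ (i, l)) (\<lambda>j. app n k x j + s *\<^sub>R x j) i = x i" if i: "i < n" for x i
      proof -
        have row: "(\<Sum>j<n. A (of_real (- s)) $$ (l, j) * x j) = - (app n k x l + s *\<^sub>R x l)" if "l < n" for l
        proof -
          have "(\<Sum>j<n. A (of_real (- s)) $$ (l, j) * x j)
              = (\<Sum>j<n. (if l = j then - (s *\<^sub>R x j) else 0) - k l j * x j)"
            using that by (intro sum.cong refl)
              (auto simp: A_ix left_diff_distrib mult_scaleC_left scaleC_minus_left scaleC_of_real)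
          then show ?thesis using that by (simp add: sum_subtractf app_def)
        qed
        have "app n (\<lambda>i l. - B $$ (i, l)) (\<lambda>j. app n k x j + s *\<^sub>R x j) i
            = (\<Sum>l<n. B $$ (i, l) * (\<Sum>j<n. A (of_real (- s)) $$ (l, j) * x j))"
          unfolding app_def[of n "\<lambda>i l. - B $$ (i, l)"] by (intro sum.cong refl) (simp add: row distrib_left right_diff_distrib del: of_real_minus)
        also have "\<dots> = (\<Sum>j<n. (\<Sum>l<n. B $$ (i, l) * A (of_real (- s)) $$ (l, j)) * x j)"
          unfolding sum_distrib_left sum_distrib_right by (subst sum.swap) (simp add: mult.assoc)
        also have "\<dots> = (\<Sum>j<n. if i = j then x j else 0)"
          using i by (intro sum.cong refl) (simp add: ix del: of_real_minus)
        finally show ?thesis using i by simp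
      qed
      then show ?thesis by blast
    qed
    then obtain B where "\<And>s x i. s > 0 \<Longrightarrow> i < n \<Longrightarrow> app n (B s) (\<lambda>j. app n k x j + s *\<^sub>R x j) i = x i"
      by metis
    with h show "positive_form n k" by (rule positive_form_of_invertible_shifts)
  next
    assume pf: "positive_form n k"
    then have h: "hermitian n k" by (simp add: coercive_def)
    have right: "\<exists>R\<in>carrier_mat n n. A w * R = 1\<^sub>m n" if w: "w \<notin> \<real>\<^sub>\<ge>\<^sub>0" for w
    proof -
      have "\<exists>x. \<forall>i<n. w *\<^sub>C x i - app n k x i = (if i = j then 1 else 0)" for j
        by (rule positive_form_resolvent_solvable[OF pf w])
      then obtain X where X: "\<And>j i. i < n \<Longrightarrow> w *\<^sub>C X j i - app n k (X j) i = (if i = j then 1 else 0)"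
        by metis
      define R where "R = Matrix.mat n n (\<lambda>(i, j). X j i)"
      have R: "R \<in> carrier_mat n n" by (simp add: R_def)
      have "A w * R = 1\<^sub>m n"
      proof (rule eq_matI)
        fix i j assume "i < dim_row (1\<^sub>m n :: 'a mat)" "j < dim_col (1\<^sub>m n :: 'a mat)"
        then have ij: "i < n" "j < n" by simp_all
        have "(A w * R) $$ (i, j) = (\<Sum>l<n. (if i = l then w *\<^sub>C X j l else 0) - k i l * X j l)"
          unfolding mult_ix[OF A R ij] using ij
          by (intro sum.cong refl) (auto simp: A_ix R_def left_diff_distrib mult_scaleC_left)
        also have "\<dots> = w *\<^sub>C X j i - app n k (X j) i"
          using ij by (simp add: sum_subtractf app_def)
        finally show "(A w * R) $$ (i, j) = 1\<^sub>m n $$ (i, j)" using ij X by simp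
      qed (use A[of w] R in auto)
      with R show ?thesis by blast
    qed
    have "invertible_mat (A w)" if w: "w \<notin> \<real>\<^sub>\<ge>\<^sub>0" for w
    proof -
      obtain R where R: "R \<in> carrier_mat n n" "A w * R = 1\<^sub>m n" using right[OF w] by blast
      have "cnj w \<notin> \<real>\<^sub>\<ge>\<^sub>0" using w by (simp add: complex_nonneg_Reals_iff)
      then obtain W where W: "W \<in> carrier_mat n n" "A (cnj w) * W = 1\<^sub>m n" using right by blast
      \<comment> \<open>The adjoint of a right inverse of \<open>cnj w - k\<close> is a left inverse of \<open>w - k\<close>.\<close>
      define L where "L = Matrix.mat n n (\<lambda>(i, j). star (W $$ (j, i)))"
      have L: "L \<in> carrier_mat n n" by (simp add: L_def)
      have "L * A w = 1\<^sub>m n"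
      proof (rule eq_matI)
        fix i j assume "i < dim_row (1\<^sub>m n :: 'a mat)" "j < dim_col (1\<^sub>m n :: 'a mat)"
        then have ij: "i < n" "j < n" by simp_all
        have "(L * A w) $$ (i, j) = (\<Sum>l<n. star (A (cnj w) $$ (j, l) * W $$ (l, i)))"
          unfolding mult_ix[OF L A ij] using ij
          by (intro sum.cong refl)
            (auto simp: L_def A_ix star_mult star_diff star_scaleC hermitianD[OF h])
        also have "\<dots> = star ((A (cnj w) * W) $$ (j, i))"
          unfolding mult_ix[OF A W(1) ij(2,1)] by (simp add: star_sum)
        finally show "(L * A w) $$ (i, j) = 1\<^sub>m n $$ (i, j)" using ij by (simp add: W(2))
      qed (use A[of w] L in auto)
      moreover have "L = R"
        using assoc_mult_mat[OF L A[of w] R(1)] calculation R L by simp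
      ultimately show ?thesis
        using R A[of w] by (auto simp: invertible_mat_def inverts_mat_def)
    qed
    then have "mat_spectrum ?M \<subseteq> \<real>\<^sub>\<ge>\<^sub>0" using spec by blast
    then show "mat_positive n ?M" using h star_M by (simp add: mat_positive_def)
  qed
qed

section \<open>The center\<close>

lemma algebra_centerD: "z \<in> algebra_center \<Longrightarrow> z * a = a * z"
  by (simp add: algebra_center_def)

lemma center_add: "a \<in> algebra_center \<Longrightarrow> b \<in> algebra_center \<Longrightarrow> a + b \<in> algebra_center"
  by (simp add: algebra_center_def distrib_left distrib_right)

lemma center_diff: "a \<in> algebra_center \<Longrightarrow> b \<in> algebra_center \<Longrightarrow> a - b \<in> algebra_center"
  by (simp add: algebra_center_def left_diff_distrib right_diff_distrib)

lemma center_mult: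
  assumes "a \<in> algebra_center" "b \<in> algebra_center"
  shows "a * b \<in> algebra_center"
  unfolding algebra_center_def
proof (intro CollectI allI)
  fix c
  have "a * b * c = a * c * b" using algebra_centerD[OF assms(2), of c] by (simp add: mult.assoc)
  also have "\<dots> = c * (a * b)" using algebra_centerD[OF assms(1), of c] by (simp add: mult.assoc)
  finally show "a * b * c = c * (a * b)" .
qed

lemma center_scaleR: "a \<in> algebra_center \<Longrightarrow> r *\<^sub>R a \<in> algebra_center"
  by (simp add: algebra_center_def)

lemma center_0: "0 \<in> algebra_center"
  by (simp add: algebra_center_def)

lemma center_1: "1 \<in> algebra_center"
  by (simp add: algebra_center_def)

lemma center_of_real: "of_real r \<in> algebra_center"
  unfolding of_real_def by (intro center_scaleR center_1)

lemma center_star: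
  assumes "a \<in> algebra_center"
  shows "star a \<in> algebra_center"
  unfolding algebra_center_def
proof (intro CollectI allI)
  fix c
  show "star a * c = c * star a"
    using arg_cong[OF algebra_centerD[OF assms, of "star c"], of star] by (simp add: star_mult star_star)
qed

lemma center_power: "a \<in> algebra_center \<Longrightarrow> a ^ m \<in> algebra_center"
  by (induction m) (auto intro: center_1 center_mult)

lemma center_sum: "(\<And>i. i \<in> I \<Longrightarrow> f i \<in> algebra_center) \<Longrightarrow> sum f I \<in> algebra_center"
  by (induction I rule: infinite_finite_induct) (auto intro: center_0 center_add)

lemma center_limit:
  fixes f :: "nat \<Rightarrow> 'a::unital_cstar_algebra"
  assumes f: "\<And>m. f m \<in> algebra_center" and lim: "f \<longlonglongrightarrow> a"
  shows "a \<in> algebra_center"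
  unfolding algebra_center_def
proof (intro CollectI allI)
  fix c
  have "(\<lambda>m. f m * c) \<longlonglongrightarrow> a * c" "(\<lambda>m. c * f m) \<longlonglongrightarrow> c * a" by (intro tendsto_intros lim)+
  then show "a * c = c * a" using LIMSEQ_unique f by (simp add: algebra_centerD)
qed

lemma center_exp:
  assumes "(a::'a::unital_cstar_algebra) \<in> algebra_center"
  shows "exp a \<in> algebra_center"
proof (rule center_limit)
  show "(\<lambda>m. \<Sum>i<m. a ^ i /\<^sub>R fact i) \<longlonglongrightarrow> exp a"
    using exp_converges[of a] by (simp add: sums_def)
  show "(\<Sum>i<m. a ^ i /\<^sub>R fact i) \<in> algebra_center" for m
    by (intro center_sum center_scaleR center_power assms)
qed

lemma center_inverse:
  assumes p: "p \<in> algebra_center" and q: "q * p = 1" "p * q = 1"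
  shows "q \<in> algebra_center"
  unfolding algebra_center_def
proof (intro CollectI allI)
  fix c
  have "q * c = q * (c * p) * q" using q by (simp add: mult.assoc)
  also have "\<dots> = (q * p) * c * q" unfolding algebra_centerD[OF p, of c, symmetric] by (simp add: mult.assoc)
  finally show "q * c = c * q" using q by simp
qed

section \<open>Schur products and exponentials of central kernels\<close>

lemma positive_form_restrict:
  assumes "positive_form (Suc n) k"
  shows "positive_form n k"
  unfolding positive_form_iff
proof (intro conjI allI)
  show "hermitian n k" using assms by (simp add: coercive_def hermitian_def)
  fix x
  have "form (Suc n) k (x(n := 0)) = form n k (x(n := 0))" by (simp add: form_def)
  also have "\<dots> = form n k x" by (rule form_cong) simp_all
  finally show "form n k x \<in> positive_cone" using assms by (metis positive_form_iff)
qed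

text \<open>
  Eliminating the last index writes \<open>l\<close> as a kernel of rank one plus its Schur complement, which is
  coercive of smaller size. The rank one part \<open>l j n * q * l n i\<close> contributes the form of
  \<open>k\<close> at the vector with entries \<open>s * l j n * x j\<close>, where \<open>s\<close> is the
  square root of the inverse \<open>q\<close> of the pivot: since \<open>l\<close> and \<open>s\<close> are
  central, the factors can be moved across \<open>k\<close>. The product is formed with the transpose of
  \<open>l\<close> because this version also yields the positivity of the transpose itself, by taking
  \<open>k\<close> constantly one.
\<close>
lemma schur_product_transpose_coercive:
  fixes k l :: "nat \<Rightarrow> nat \<Rightarrow> 'a::unital_cstar_algebra"
  assumes "coercive n \<epsilon> l" "\<epsilon> > 0" "\<And>i j. i < n \<Longrightarrow> j < n \<Longrightarrow> l i j \<in> algebra_center"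
    and "positive_form n k"
  shows "form n (\<lambda>i j. k i j * l j i) x \<in> positive_cone"
  using assms(1,3,4)
proof (induction n arbitrary: l)
  case 0
  then show ?case by (simp add: form_def)
next
  case (Suc n)
  obtain q where q: "q * l n n = 1" "l n n * q = 1" "q \<in> positive_cone"
    "coercive n \<epsilon> (schur_compl n q l)"
    using coercive_pivot[OF Suc.prems(1) assms(2)] by metis
  have lc: "l i j \<in> algebra_center" if "i < Suc n" "j < Suc n" for i j using Suc.prems(2) that .
  have qc: "q \<in> algebra_center" using center_inverse[OF lc q(1,2)] by simp
  have lh: "hermitian (Suc n) l" using Suc.prems(1) by (simp add: coercive_def)
  obtain s where s: "s \<in> positive_cone" "s * s = q" "\<And>b. q * b = b * q \<Longrightarrow> s * b = b * s"
    using positive_sqrt[OF q(3)] by blast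
  have sc: "s \<in> algebra_center" using s(3) algebra_centerD[OF qc] by (simp add: algebra_center_def)
  have ssa: "star s = s" using s(1) by (rule positive_cone_self_adjoint)
  let ?c = "schur_compl n q l"
  have c0: "?c n i = 0" "?c i n = 0" for i
    using q(1,2) by (simp_all add: schur_compl_def mult.assoc)
  have "form n (\<lambda>i j. k i j * ?c j i) x \<in> positive_cone"
  proof (rule Suc.IH[OF q(4)])
    show "?c i j \<in> algebra_center" if "i < n" "j < n" for i j
      unfolding schur_compl_def using that by (intro center_diff center_mult lc qc) auto
    show "positive_form n k" using Suc.prems(3) by (rule positive_form_restrict)
  qed
  moreover have "form (Suc n) (\<lambda>i j. k i j * ?c j i) x = form n (\<lambda>i j. k i j * ?c j i) x"
    by (simp add: form_def c0)
  moreover define u where "u j = s * l j n * x j" for j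
  have "form (Suc n) (\<lambda>i j. k i j * (l j n * q * l n i)) x = form (Suc n) k u"
    unfolding form_def
  proof (intro sum.cong refl)
    fix i j assume ij: "i \<in> {..<Suc n}" "j \<in> {..<Suc n}"
    have nsc: "l n i * s \<in> algebra_center" using ij by (intro center_mult lc sc) auto
    have "star (u i) = star (x i) * (l n i * s)"
      using ij hermitianD[OF lh, of i n] by (simp add: u_def star_mult ssa mult.assoc)
    then have "star (u i) * k i j * u j = star (x i) * ((l n i * s) * k i j) * (s * l j n) * x j"
      by (simp add: u_def mult.assoc)
    also have "\<dots> = star (x i) * k i j * (((l n i * s) * (s * l j n)) * x j)"
      unfolding algebra_centerD[OF nsc, of "k i j"] by (simp add: mult.assoc)
    also have "(l n i * s) * (s * l j n) = l n i * (q * l j n)"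
      by (simp add: s(2)[symmetric] mult.assoc)
    also have "\<dots> = q * l j n * l n i"
      using ij by (intro algebra_centerD lc) auto
    also have "q * l j n = l j n * q" by (rule algebra_centerD[OF qc])
    finally show "star (x i) * (k i j * (l j n * q * l n i)) * x j = star (u i) * k i j * u j"
      by (simp add: mult.assoc)
  qed
  moreover have "form (Suc n) k u \<in> positive_cone"
    using Suc.prems(3) by (simp add: positive_form_iff)
  moreover have "form (Suc n) (\<lambda>i j. k i j * l j i) x
      = form (Suc n) (\<lambda>i j. k i j * ?c j i) x + form (Suc n) (\<lambda>i j. k i j * (l j n * q * l n i)) x"
    unfolding form_def sum.distrib[symmetric] schur_compl_def
    by (intro sum.cong refl) (simp add: right_diff_distrib left_diff_distrib)
  ultimately show ?case by (simp add: positive_cone_add)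
qed

lemma positive_form_limit:
  assumes k: "\<And>m. positive_form n (k m)"
    and lim: "\<And>i j. i < n \<Longrightarrow> j < n \<Longrightarrow> (\<lambda>m. k m i j) \<longlonglongrightarrow> l i j"
  shows "positive_form n l"
  unfolding positive_form_iff
proof (intro conjI allI)
  show "hermitian n l"
    unfolding hermitian_def
  proof (intro allI impI)
    fix i j assume ij: "i < n" "j < n"
    have "(\<lambda>m. star (k m i j)) \<longlonglongrightarrow> star (l i j)"
      by (rule bounded_linear.tendsto[OF bounded_linear_star lim[OF ij]])
    moreover have "star (k m i j) = k m j i" for m
      using k[of m] ij by (simp add: coercive_def hermitian_def)
    ultimately show "star (l i j) = l j i" using lim[OF ij(2,1)] LIMSEQ_unique by simp
  qed
  fix x
  show "form n l x \<in> positive_cone"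
  proof (rule positive_cone_limit)
    show "form n (k m) x \<in> positive_cone" for m using k[of m] by (simp add: positive_form_iff)
    show "(\<lambda>m. form n (k m) x) \<longlonglongrightarrow> form n l x"
      unfolding form_def by (intro tendsto_intros lim) auto
  qed
qed

text \<open>
  Add a small multiple of the identity to \<open>l\<close> and let it tend to zero.
\<close>
lemma schur_product_transpose:
  fixes k l :: "nat \<Rightarrow> nat \<Rightarrow> 'a::unital_cstar_algebra"
  assumes k: "positive_form n k" and l: "positive_form n l"
    and lc: "\<And>i j. i < n \<Longrightarrow> j < n \<Longrightarrow> l i j \<in> algebra_center"
  shows "positive_form n (\<lambda>i j. k i j * l j i)"
proof (rule positive_form_limit)
  let ?l = "\<lambda>m. shift (inverse (real (Suc m))) l"
  have co: "coercive n (inverse (real (Suc m))) (?l m)" for m by (rule coercive_shift[OF l])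
  have c: "?l m i j \<in> algebra_center" if "i < n" "j < n" for m i j
    using that lc center_of_real center_add by (auto simp: shift_def intro!: center_add center_of_real)
  show "positive_form n (\<lambda>i j. k i j * ?l m j i)" for m
    unfolding positive_form_iff
  proof (intro conjI allI)
    show "hermitian n (\<lambda>i j. k i j * ?l m j i)"
      using k co[of m] c[of _ _ m] by (auto simp: coercive_def hermitian_def star_mult algebra_centerD)
    show "form n (\<lambda>i j. k i j * ?l m j i) x \<in> positive_cone" for x
      by (rule schur_product_transpose_coercive[OF co _ c k]) auto
  qed
  fix i j assume "i < n" "j < n"
  have "(\<lambda>m. k i j * (l j i + (if j = i then of_real (inverse (real (Suc m))) else 0)))
      \<longlonglongrightarrow> k i j * (l j i + of_real 0)"
  proof (cases "j = i")
    case True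
    show ?thesis unfolding if_P[OF True] by (intro tendsto_intros LIMSEQ_inverse_real_of_nat)
  qed simp
  then show "(\<lambda>m. k i j * ?l m j i) \<longlonglongrightarrow> k i j * l j i"
    by (simp add: shift_def del: of_nat_Suc)
qed

lemma positive_form_one: "positive_form n (\<lambda>i j. 1 :: 'a::unital_cstar_algebra)"
proof -
  have "form n (\<lambda>i j. 1) x = star (\<Sum>i<n. x i) * (\<Sum>i<n. x i)" for x :: "nat \<Rightarrow> 'a"
    by (simp add: form_def star_sum sum_distrib_left sum_distrib_right) (rule sum.swap)
  then show ?thesis by (simp add: positive_form_iff hermitian_def star_mult_self_positive)
qed

text \<open>
  For entries that do not commute the transpose of a positive matrix need not be positive.
\<close>
lemma positive_form_transpose:
  assumes "positive_form n l" "\<And>i j. i < n \<Longrightarrow> j < n \<Longrightarrow> l i j \<in> algebra_center"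
  shows "positive_form n (\<lambda>i j. l j i)"
  using schur_product_transpose[OF positive_form_one assms] by simp

lemma schur_product:
  assumes "positive_form n k" "positive_form n l"
    and "\<And>i j. i < n \<Longrightarrow> j < n \<Longrightarrow> l i j \<in> algebra_center"
  shows "positive_form n (\<lambda>i j. k i j * l i j)"
  using schur_product_transpose[OF assms(1) positive_form_transpose[OF assms(2,3)]] assms(3) by simp

lemma positive_form_add:
  assumes "positive_form n k" "positive_form n l"
  shows "positive_form n (\<lambda>i j. k i j + l i j)"
proof -
  have "form n (\<lambda>i j. k i j + l i j) x = form n k x + form n l x" for x
    by (simp add: form_def distrib_left distrib_right sum.distrib)
  then show ?thesis
    using assms by (simp add: positive_form_iff hermitian_def star_add positive_cone_add)
qed

lemma positive_form_scaleR:
  assumes "positive_form n k" "c \<ge> 0"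
  shows "positive_form n (\<lambda>i j. c *\<^sub>R k i j)"
proof -
  have "form n (\<lambda>i j. c *\<^sub>R k i j) x = c *\<^sub>R form n k x" for x
    by (simp add: form_def scaleR_sum_right)
  then show ?thesis
    using assms by (simp add: positive_form_iff hermitian_def star_scaleR positive_cone_scaleR)
qed

text \<open>
  All entrywise powers are positive by the Schur product theorem, hence so are the partial sums of the
  exponential series.
\<close>
lemma positive_form_exp:
  assumes q: "positive_form n q" and qc: "\<And>i j. i < n \<Longrightarrow> j < n \<Longrightarrow> q i j \<in> algebra_center"
  shows "positive_form n (\<lambda>i j. exp (q i j))"
proof (rule positive_form_limit)
  have pw: "positive_form n (\<lambda>i j. q i j ^ m)" for m
  proof (induction m)
    case (Suc m)
    have "positive_form n (\<lambda>i j. q i j ^ m * q i j)" by (rule schur_product[OF Suc q qc])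
    then show ?case by (simp add: power_commutes)
  qed (simp add: positive_form_one)
  show "positive_form n (\<lambda>i j. \<Sum>r<m. q i j ^ r /\<^sub>R fact r)" for m
  proof (induction m)
    case 0
    show ?case using positive_form_scaleR[OF positive_form_one, of 0 n] by simp
  next
    case (Suc m)
    have "positive_form n (\<lambda>i j. q i j ^ m /\<^sub>R fact m)" by (rule positive_form_scaleR[OF pw]) simp
    with Suc show ?case by (simp add: positive_form_add)
  qed
  show "(\<lambda>m. \<Sum>r<m. q i j ^ r /\<^sub>R fact r) \<longlonglongrightarrow> exp (q i j)" for i j
    using exp_converges[of "q i j"] by (simp add: sums_def)
qed

lemma bounded_linear_exp:
  assumes f: "bounded_linear f" and p: "\<And>m. f (x ^ m) = f x ^ m"
  shows "f (exp x) = exp (f x :: 'a::{real_normed_algebra_1,banach})"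
proof -
  have "(\<lambda>m. f (x ^ m /\<^sub>R fact m)) sums f (exp x)"
    by (rule bounded_linear.sums[OF f exp_converges])
  then have "(\<lambda>m. f x ^ m /\<^sub>R fact m) sums f (exp x)"
    by (simp add: linear_scale[OF bounded_linear.linear[OF f]] p)
  then show ?thesis using exp_converges sums_unique2 by blast
qed

lemma star_exp: "star (exp x) = exp (star (x::'a::unital_cstar_algebra))"
  by (rule bounded_linear_exp[OF bounded_linear_star star_power])

text \<open>
  In Schoenberg's argument \<open>exp (- t * p i j)\<close> factors as
  \<open>d i * exp (t * (c i + c j - p i j)) * d j\<close> with \<open>d i = exp (- t * c i)\<close>
  self-adjoint, so its form is that of the middle factor at the vector \<open>d j * x j\<close>.
\<close>
lemma schoenberg_kernel:
  fixes p :: "nat \<Rightarrow> nat \<Rightarrow> 'a::unital_cstar_algebra"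
  assumes q: "positive_form n (\<lambda>i j. c i + c j - p i j)"
    and c: "\<And>i. i < n \<Longrightarrow> c i \<in> algebra_center" "\<And>i. i < n \<Longrightarrow> star (c i) = c i"
    and p: "\<And>i j. i < n \<Longrightarrow> j < n \<Longrightarrow> p i j \<in> algebra_center"
    and t: "t \<ge> 0"
  shows "positive_form n (\<lambda>i j. exp (- t *\<^sub>R p i j))"
proof -
  define r where "r i j = t *\<^sub>R (c i + c j - p i j)" for i j
  have rc: "r i j \<in> algebra_center" if "i < n" "j < n" for i j
    unfolding r_def using that by (intro center_scaleR center_diff center_add c p)
  have "positive_form n r" unfolding r_def[abs_def] by (rule positive_form_scaleR[OF q t])
  then have e: "positive_form n (\<lambda>i j. exp (r i j))" using rc by (rule positive_form_exp)
  define d where "d i = exp (- t *\<^sub>R c i)" for i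
  have ds: "star (d i) = d i" if "i < n" for i
    using c(2)[OF that] by (simp add: d_def star_exp star_scaleR)
  have split: "exp (- t *\<^sub>R p i j) = d i * exp (r i j) * d j" if ij: "i < n" "j < n" for i j
  proof -
    have cc1: "- t *\<^sub>R c i \<in> algebra_center" by (intro center_scaleR c ij)
    have cc2: "- t *\<^sub>R c i + r i j \<in> algebra_center" by (intro center_add cc1 rc ij)
    have "- t *\<^sub>R p i j = (- t *\<^sub>R c i + r i j) + - t *\<^sub>R c j"
      by (simp add: r_def algebra_simps)
    also have "exp \<dots> = exp (- t *\<^sub>R c i + r i j) * d j"
      unfolding d_def by (rule exp_add_commuting[OF algebra_centerD[OF cc2]])
    also have "exp (- t *\<^sub>R c i + r i j) = d i * exp (r i j)"
      unfolding d_def by (rule exp_add_commuting[OF algebra_centerD[OF cc1]])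
    finally show ?thesis .
  qed
  have "hermitian n (\<lambda>i j. exp (- t *\<^sub>R p i j))"
    unfolding hermitian_def
  proof (intro allI impI)
    fix i j assume ij: "i < n" "j < n"
    have "star (exp (r i j)) = exp (r j i)" using e ij by (simp add: coercive_def hermitian_def)
    then show "star (exp (- t *\<^sub>R p i j)) = exp (- t *\<^sub>R p j i)"
      unfolding split[OF ij] split[OF ij(2,1)] using ds ij by (simp add: star_mult mult.assoc)
  qed
  moreover have "form n (\<lambda>i j. exp (- t *\<^sub>R p i j)) x = form n (\<lambda>i j. exp (r i j)) (\<lambda>j. d j * x j)" for x
    unfolding form_def
  proof (intro sum.cong refl)
    fix i j assume "i \<in> {..<n}" "j \<in> {..<n}"
    then have ij: "i < n" "j < n" by simp_all
    show "star (x i) * exp (- t *\<^sub>R p i j) * x j = star (d i * x i) * exp (r i j) * (d j * x j)"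
      unfolding split[OF ij] by (simp add: star_mult ds[OF ij(1)] mult.assoc)
  qed
  ultimately show ?thesis using e by (simp add: positive_form_iff)
qed

lemma norm_exp_minus_one:
  fixes x :: "'a::{real_normed_algebra_1,banach}"
  shows "norm (exp x - 1) \<le> exp (norm x) - 1"
proof -
  have s: "summable (\<lambda>n. norm (inverse (fact (Suc n)) *\<^sub>R x ^ Suc n))"
    using summable_norm_exp[of x] by (subst summable_Suc_iff)
  have s': "summable (\<lambda>n. inverse (fact (Suc n)) *\<^sub>R norm x ^ Suc n)"
    using summable_exp_generic[of "norm x"] by (subst summable_Suc_iff)
  have "norm (exp x - 1) = norm (\<Sum>n. inverse (fact (Suc n)) *\<^sub>R x ^ Suc n)"
    using exp_first_term[of x] by simp
  also have "\<dots> \<le> (\<Sum>n. norm (inverse (fact (Suc n)) *\<^sub>R x ^ Suc n))"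
    by (rule summable_norm[OF s])
  also have "\<dots> \<le> (\<Sum>n. inverse (fact (Suc n)) *\<^sub>R norm x ^ Suc n)"
    by (intro suminf_le[OF _ s s']) (auto simp del: fact_Suc power_Suc intro!: mult_left_mono norm_power_ineq)
  also have "\<dots> = exp (norm x) - 1"
    using exp_first_term[of "norm x"] by simp
  finally show ?thesis .
qed

text \<open>
  Since \<open>norm w - w\<close> has norm at most \<open>norm w\<close>, the two factors of
  \<open>exp (- norm w) * exp (norm w - w)\<close> have norms at most \<open>exp (- norm w)\<close> and
  \<open>exp (norm w)\<close>.
\<close>
lemma norm_exp_minus_positive:
  assumes "(w::'a::unital_cstar_algebra) \<in> positive_cone"
  shows "norm (exp (- w)) \<le> 1"
proof -
  have "exp (- w) = exp (of_real (- norm w) + (of_real (norm w) - w))" by simp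
  also have "\<dots> = exp (of_real (- norm w)) * exp (of_real (norm w) - w)"
    by (rule exp_add_commuting) (rule algebra_centerD[OF center_of_real])
  also have "norm \<dots> \<le> norm (exp (of_real (- norm w) :: 'a)) * norm (exp (of_real (norm w) - w))"
    by (rule norm_mult_ineq)
  also have "\<dots> \<le> exp (- norm w) * exp (norm w)"
  proof (rule mult_mono)
    have "exp (of_real (- norm w) :: 'a) = of_real (exp (- norm w))"
      by (rule bounded_linear_exp[symmetric]) (simp_all add: bounded_linear_of_real)
    then show "norm (exp (of_real (- norm w) :: 'a)) \<le> exp (- norm w)"
      by (simp del: of_real_minus)
    have "norm (exp (of_real (norm w) - w)) \<le> exp (norm (of_real (norm w) - w))" by (rule norm_exp)
    also have "\<dots> \<le> exp (norm w)" using positive_cone_norm_char(2)[OF assms order_refl] by simp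
    finally show "norm (exp (of_real (norm w) - w)) \<le> exp (norm w)" .
  qed simp_all
  also have "\<dots> = 1" by (simp flip: exp_add)
  finally show ?thesis .
qed

section \<open>Automorphisms and actions\<close>

lemma star_automorphism_simps:
  assumes "star_automorphism f"
  shows "f (x + y) = f x + f y" "f (c *\<^sub>C x) = c *\<^sub>C f x" "f (x * y) = f x * f y"
    "f (star x) = star (f x)" "f 0 = 0" "f (- x) = - f x" "f (x - y) = f x - f y"
    "f (r *\<^sub>R x) = r *\<^sub>R f x" "f 1 = 1"
proof -
  note f = assms[unfolded star_automorphism_def]
  show add: "f (x + y) = f x + f y" for x y using f by blast
  show scC: "f (c *\<^sub>C x) = c *\<^sub>C f x" for c x using f by blast
  show mult: "f (x * y) = f x * f y" for x y using f by blast
  show "f (star x) = star (f x)" using f by blast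
  show zero: "f 0 = 0" using add[of 0 0] by simp
  show minus: "f (- x) = - f x" for x using add[of x "- x"] zero by (simp add: eq_neg_iff_add_eq_0 add.commute)
  show "f (x - y) = f x - f y" using add[of x "- y"] minus by simp
  show "f (r *\<^sub>R x) = r *\<^sub>R f x" by (simp add: scaleR_eq_scaleC scC)
  obtain y where "f y = 1" using f by (metis bij_pointE)
  then show "f 1 = 1" using mult[of 1 y] by simp
qed

lemma star_automorphism_spectrum:
  assumes f: "star_automorphism f"
  shows "alg_spectrum (f a) \<subseteq> alg_spectrum a"
proof -
  have "alg_invertible (f b)" if "alg_invertible b" for b
    using that unfolding alg_invertible_def by (metis star_automorphism_simps(3,9)[OF f])
  then have "alg_invertible (z *\<^sub>C 1 - f a)" if "alg_invertible (z *\<^sub>C 1 - a)" for z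
    using that by (metis star_automorphism_simps(2,7,9)[OF f])
  then show ?thesis by (auto simp: mem_alg_spectrum_iff)
qed

lemma star_automorphism_positive:
  "star_automorphism f \<Longrightarrow> a \<in> positive_cone \<Longrightarrow> f a \<in> positive_cone"
  using star_automorphism_spectrum[of f a] star_automorphism_simps(4)[of f a]
  by (auto simp: positive_cone_def)

lemma star_automorphism_center:
  assumes f: "star_automorphism f" and a: "a \<in> algebra_center"
  shows "f a \<in> algebra_center"
  unfolding algebra_center_def
proof (intro CollectI allI)
  fix c
  obtain b where "c = f b" using f unfolding star_automorphism_def by (metis bij_pointE)
  then show "f a * c = c * f a" using algebra_centerD[OF a] by (metis star_automorphism_simps(3)[OF f])
qed

text \<open>
  On self-adjoint elements an automorphism does not increase the spectral radius, which is the norm; the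
  C*-identity extends this to all elements.
\<close>
lemma star_automorphism_bounded_linear:
  assumes f: "star_automorphism f"
  shows "bounded_linear f"
proof (rule bounded_linear_intro[where K=1])
  have sa: "norm (f a) \<le> norm a" if a: "star a = a" for a
  proof -
    have "star (f a) = f a" using a star_automorphism_simps(4)[OF f, of a] by simp
    then obtain z where "z \<in> alg_spectrum (f a)" "cmod z = norm (f a)" by (rule spectrum_attains_norm)
    then show ?thesis using star_automorphism_spectrum[OF f] spectrum_norm_bound by (metis subsetD)
  qed
  fix x
  have "(norm (f x))\<^sup>2 = norm (f (star x * x))"
    by (simp add: star_automorphism_simps[OF f] norm_star_mult_self)
  also have "\<dots> \<le> (norm x)\<^sup>2"
    using sa[of "star x * x"] by (simp add: star_mult star_star norm_star_mult_self)
  finally show "norm (f x) \<le> norm x * 1" by (simp add: power_mono_iff)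
qed (simp_all add: star_automorphism_simps[OF f])

lemma star_automorphism_exp:
  assumes f: "star_automorphism f"
  shows "f (exp x) = exp (f x)"
proof (rule bounded_linear_exp[OF star_automorphism_bounded_linear[OF f]])
  show "f (x ^ m) = f x ^ m" for m by (induction m) (simp_all add: star_automorphism_simps[OF f])
qed

locale cstar_action = group G for G (structure) +
  fixes \<alpha> :: "'g \<Rightarrow> 'a::unital_cstar_algebra \<Rightarrow> 'a"
  assumes action: "\<alpha> \<in> hom G Aut"
begin

lemma action_automorphism: "g \<in> carrier G \<Longrightarrow> star_automorphism (\<alpha> g)"
  using action by (auto simp: hom_def Aut_def)

lemma action_mult: "g \<in> carrier G \<Longrightarrow> h \<in> carrier G \<Longrightarrow> \<alpha> (g \<otimes> h) x = \<alpha> g (\<alpha> h x)"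
  using action by (auto simp: hom_def Aut_def)

lemma action_one: "\<alpha> \<one> x = x"
proof -
  have "\<alpha> \<one> (\<alpha> \<one> x) = \<alpha> \<one> x" using action_mult[of \<one> \<one> x] by simp
  moreover have "inj (\<alpha> \<one>)" using action_automorphism[of \<one>] by (simp add: star_automorphism_def bij_def)
  ultimately show ?thesis by (metis injD)
qed

lemmas action_simps = star_automorphism_simps[OF action_automorphism]

abbreviation kernel :: "('g \<Rightarrow> 'a) \<Rightarrow> (nat \<Rightarrow> 'g) \<Rightarrow> nat \<Rightarrow> nat \<Rightarrow> 'a" where
  "kernel \<phi> g i j \<equiv> \<alpha> (g i) (\<phi> (inv (g i) \<otimes> g j))"

lemma positive_definite_iff:
  "positive_definite G \<alpha> \<phi> \<longleftrightarrow> (\<forall>n g. (\<forall>i<n. g i \<in> carrier G) \<longrightarrow> positive_form n (kernel \<phi> g))"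
  by (simp add: positive_definite_def mat_positive_iff_positive_form)

lemma negative_definite_iff:
  "negative_definite G \<alpha> \<psi> \<longleftrightarrow>
    (\<forall>g\<in>carrier G. \<alpha> g (\<psi> (inv g)) = star (\<psi> g)) \<and>
    (\<forall>n g b. (\<forall>i<n. g i \<in> carrier G) \<longrightarrow> (\<Sum>i<n. b i) = 0 \<longrightarrow> - form n (kernel \<psi> g) b \<in> positive_cone)"
  by (simp add: negative_definite_def form_def cstar_le_def)

lemma kernel_center:
  assumes "\<phi> \<in> carrier G \<rightarrow> algebra_center" "g i \<in> carrier G" "g j \<in> carrier G"
  shows "kernel \<phi> g i j \<in> algebra_center"
  by (rule star_automorphism_center[OF action_automorphism[OF assms(2)]]) (use assms in auto)

section \<open>From negative definite to positive definite functions\<close>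

text \<open>
  Extend \<open>g\<close> by the base point \<open>\<one>\<close>, and \<open>b\<close> by minus the sum of its
  entries, so that the extended vector sums to zero. Since \<open>\<psi>\<close> vanishes at
  \<open>\<one>\<close>, the negative definite form at the extended data is minus the form of
  \<open>\<psi> (g i) + \<psi> (g j) - kernel \<psi> g i j\<close> at \<open>b\<close>.
\<close>
lemma positive_form_of_negative_definite:
  assumes neg: "negative_definite G \<alpha> \<psi>" and norm: "normalized G \<psi>"
    and pos: "\<psi> \<in> carrier G \<rightarrow> positive_cone" and g: "\<And>i. i < n \<Longrightarrow> g i \<in> carrier G"
  shows "positive_form n (\<lambda>i j. \<psi> (g i) + \<psi> (g j) - kernel \<psi> g i j)"
  unfolding positive_form_iff
proof (intro conjI allI)
  have herm: "\<alpha> x (\<psi> (inv x)) = \<psi> x" if "x \<in> carrier G" for x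
    using neg pos that positive_cone_self_adjoint by (auto simp: negative_definite_iff)
  have sym: "kernel \<psi> g j i = kernel \<psi> g i j" if ij: "i < n" "j < n" for i j
  proof -
    define x where "x = inv (g i) \<otimes> g j"
    have x: "x \<in> carrier G" using g ij by (simp add: x_def)
    have "inv x = inv (g j) \<otimes> g i" using g ij by (simp add: x_def inv_mult_group)
    moreover have "g j = g i \<otimes> x" using g ij by (simp add: x_def m_assoc[symmetric])
    ultimately have "kernel \<psi> g j i = \<alpha> (g i \<otimes> x) (\<psi> (inv x))" by simp
    also have "\<dots> = \<alpha> (g i) (\<psi> x)" using g ij x by (simp add: action_mult herm)
    finally show ?thesis by (simp add: x_def)
  qed
  have sa: "star (kernel \<psi> g i j) = kernel \<psi> g i j" if ij: "i < n" "j < n" for i j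
  proof -
    have "\<psi> (inv (g i) \<otimes> g j) \<in> positive_cone" using g[OF ij(1)] g[OF ij(2)] pos by auto
    then show ?thesis
      by (rule positive_cone_self_adjoint[OF star_automorphism_positive[OF action_automorphism[OF g[OF ij(1)]]]])
  qed
  have sa': "star (\<psi> (g i)) = \<psi> (g i)" if "i < n" for i
    using pos g[OF that] positive_cone_self_adjoint by blast
  show "hermitian n (\<lambda>i j. \<psi> (g i) + \<psi> (g j) - kernel \<psi> g i j)"
    by (simp add: hermitian_def star_diff star_add sa sa' sym)
  fix b :: "nat \<Rightarrow> 'a"
  define S where "S = (\<Sum>i<n. b i)"
  define g' where "g' = g(n := \<one>)"
  define b' where "b' = b(n := - S)"
  have g'c: "\<forall>i<Suc n. g' i \<in> carrier G" using g by (simp add: g'_def less_Suc_eq)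
  have "(\<Sum>i<Suc n. b' i) = 0" by (simp add: b'_def S_def)
  then have N: "- form (Suc n) (kernel \<psi> g') b' \<in> positive_cone"
    using neg g'c unfolding negative_definite_iff by blast
  have k1: "kernel \<psi> g' i n = \<psi> (g i)" if "i < n" for i
    using g[OF that] that herm by (simp add: g'_def)
  have k2: "kernel \<psi> g' n j = \<psi> (g j)" if "j < n" for j
    using g[OF that] that by (simp add: g'_def action_one)
  have k3: "kernel \<psi> g' n n = 0"
    using norm by (simp add: g'_def action_one normalized_def)
  have "form (Suc n) (kernel \<psi> g') b'
    = (\<Sum>i<n. (\<Sum>j<n. star (b' i) * kernel \<psi> g' i j * b' j) + star (b' i) * kernel \<psi> g' i n * b' n)
      + ((\<Sum>j<n. star (b' n) * kernel \<psi> g' n j * b' j) + star (b' n) * kernel \<psi> g' n n * b' n)"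
    by (simp add: form_def)
  also have "\<dots> = (\<Sum>i<n. (\<Sum>j<n. star (b i) * kernel \<psi> g i j * b j) - star (b i) * \<psi> (g i) * S)
      - (\<Sum>j<n. star S * \<psi> (g j) * b j)"
    unfolding k3
    by (simp add: k1 k2 b'_def sum_negf) (simp add: g'_def)
  also have "\<dots> = - form n (\<lambda>i j. \<psi> (g i) + \<psi> (g j) - kernel \<psi> g i j) b"
  proof -
    have 1: "(\<Sum>i<n. star (b i) * \<psi> (g i) * S) = (\<Sum>i<n. \<Sum>j<n. star (b i) * \<psi> (g i) * b j)"
      by (simp add: S_def sum_distrib_left)
    have 2: "(\<Sum>j<n. star S * \<psi> (g j) * b j) = (\<Sum>i<n. \<Sum>j<n. star (b i) * \<psi> (g j) * b j)"
      unfolding S_def star_sum sum_distrib_right by (rule sum.swap)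
    show ?thesis
      unfolding sum_subtractf 1 2 form_def
      by (simp add: distrib_left distrib_right left_diff_distrib right_diff_distrib sum.distrib sum_subtractf)
  qed
  finally show "form n (\<lambda>i j. \<psi> (g i) + \<psi> (g j) - kernel \<psi> g i j) b \<in> positive_cone" using N by simp
qed

lemma positive_definite_exp:
  assumes neg: "negative_definite G \<alpha> \<psi>" and norm: "normalized G \<psi>"
    and \<psi>: "\<psi> \<in> carrier G \<rightarrow> center_positive" and t: "t \<ge> 0"
  shows "positive_definite G \<alpha> (\<lambda>g. exp (- t *\<^sub>R \<psi> g))"
  unfolding positive_definite_iff
proof (intro allI impI)
  fix n and g :: "nat \<Rightarrow> 'g" assume g: "\<forall>i<n. g i \<in> carrier G"
  have pos: "\<psi> \<in> carrier G \<rightarrow> positive_cone" and cen: "\<psi> \<in> carrier G \<rightarrow> algebra_center"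
    using \<psi> by (auto simp: center_positive_def)
  have "positive_form n (\<lambda>i j. exp (- t *\<^sub>R kernel \<psi> g i j))"
  proof (rule schoenberg_kernel[OF positive_form_of_negative_definite[OF neg norm pos] _ _ _ t])
    fix i assume i: "i < n"
    with g show "g i \<in> carrier G" by simp
    then show "\<psi> (g i) \<in> algebra_center" "star (\<psi> (g i)) = \<psi> (g i)"
      using cen pos positive_cone_self_adjoint by blast+
    fix j assume "j < n"
    with g i show "kernel \<psi> g i j \<in> algebra_center" by (intro kernel_center cen) auto
  qed
  then show "positive_form n (kernel (\<lambda>x. exp (- t *\<^sub>R \<psi> x)) g)"
    using g unfolding coercive_def hermitian_def form_def
    by (simp add: star_automorphism_exp[OF action_automorphism] action_simps)
qed

end

lemma minus_spectral_length_positive: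
  assumes "\<psi> g \<in> positive_cone"
  shows "\<psi> g - of_real (spectral_length \<psi> g) \<in> positive_cone"
  unfolding positive_cone_iff_Re
proof (intro conjI ballI)
  let ?l = "spectral_length \<psi> g"
  have sa: "star (\<psi> g) = \<psi> g" using assms by (rule positive_cone_self_adjoint)
  then show "star (\<psi> g - of_real ?l) = \<psi> g - of_real ?l" by (simp add: star_diff)
  fix z assume "z \<in> alg_spectrum (\<psi> g - of_real ?l)"
  from spectrum_shift[OF this, of "of_real ?l"] have w: "z + of_real ?l \<in> alg_spectrum (\<psi> g)"
    by (simp add: scaleC_one_eq_of_real)
  then have "complex_of_real (Re z + ?l) = z + of_real ?l"
    using spectrum_self_adjoint_real[OF sa w] by (simp add: complex_eq_iff)
  with w have "Re z + ?l \<in> {r. complex_of_real r \<in> alg_spectrum (\<psi> g)}" by simp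
  moreover have "bdd_below {r. complex_of_real r \<in> alg_spectrum (\<psi> g)}"
    using assms by (intro bdd_belowI[of _ 0]) (force simp: positive_cone_iff_Re)
  ultimately have "?l \<le> Re z + ?l" unfolding spectral_length_def by (rule cInf_lower)
  then show "0 \<le> Re z" by simp
qed

lemma spectral_length_ge:
  assumes "\<psi> g - of_real r \<in> positive_cone"
  shows "r \<le> spectral_length \<psi> g"
  unfolding spectral_length_def
proof (rule cInf_greatest)
  have "star (\<psi> g - of_real r) = \<psi> g - of_real r" using assms by (rule positive_cone_self_adjoint)
  then have sa: "star (\<psi> g) = \<psi> g" by (simp add: star_diff)
  then obtain z where z: "z \<in> alg_spectrum (\<psi> g)" by (rule spectrum_attains_norm)
  moreover have "z = of_real (Re z)" using spectrum_self_adjoint_real[OF sa z] by (simp add: complex_eq_iff)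
  ultimately show "{r. complex_of_real r \<in> alg_spectrum (\<psi> g)} \<noteq> {}" by (metis empty_iff mem_Collect_eq)
  fix s assume "s \<in> {r. complex_of_real r \<in> alg_spectrum (\<psi> g)}"
  then have "complex_of_real s + of_real (- r) \<in> alg_spectrum (\<psi> g + of_real (- r) *\<^sub>C 1)"
    by (intro spectrum_shift) simp
  then have "complex_of_real s + of_real (- r) \<in> alg_spectrum (\<psi> g - of_real r)"
    by (simp add: scaleC_minus_left scaleC_one_eq_of_real)
  with assms have "0 \<le> Re (complex_of_real s + of_real (- r))" unfolding positive_cone_iff_Re by blast
  then show "r \<le> s" by simp
qed

text \<open>
  Split off the scalar: \<open>\<psi> g - spectral_length \<psi> g\<close> is positive.
\<close>
lemma norm_exp_minus_le:
  assumes p: "\<psi> g \<in> positive_cone" and t: "t \<ge> 0"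
  shows "norm (exp (- t *\<^sub>R \<psi> g)) \<le> exp (- t * spectral_length \<psi> g)"
proof -
  let ?l = "spectral_length \<psi> g"
  define w where "w = t *\<^sub>R (\<psi> g - of_real ?l)"
  have w: "w \<in> positive_cone"
    unfolding w_def by (intro positive_cone_scaleR minus_spectral_length_positive p t)
  have "- t *\<^sub>R \<psi> g = of_real (- t * ?l) + - w"
    by (simp add: w_def of_real_def scaleR_diff_right)
  then have "exp (- t *\<^sub>R \<psi> g) = exp (of_real (- t * ?l)) * exp (- w)"
    using exp_add_commuting[OF algebra_centerD[OF center_of_real]] by metis
  also have "exp (of_real (- t * ?l)) = of_real (exp (- t * ?l))"
    by (rule bounded_linear_exp[symmetric]) (simp_all add: bounded_linear_of_real)
  finally have "norm (exp (- t *\<^sub>R \<psi> g)) = exp (- t * ?l) * norm (exp (- w))"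
    by (simp add: of_real_mult_left del: of_real_minus of_real_mult)
  then show ?thesis using norm_exp_minus_positive[OF w] by (simp add: mult_left_le)
qed

context cstar_action begin

text \<open>
  The functions \<open>exp (- \<psi> g / (n + 1))\<close> do it: they are positive definite by Schoenberg, and
  they vanish at infinity because their norm is at most
  \<open>exp (- spectral_length \<psi> g / (n + 1))\<close>.
\<close>
lemma haagerup_of_negative_definite:
  assumes \<psi>: "\<psi> \<in> carrier G \<rightarrow> center_positive" and neg: "negative_definite G \<alpha> \<psi>"
    and nor: "normalized G \<psi>" and proper: "spectrally_proper G \<psi>"
  shows "haagerup_property G \<alpha>"
proof -
  define t where "t n = inverse (real (Suc n))" for n
  have t: "t n > 0" for n by (simp add: t_def)
  define h where "h n g = exp (- t n *\<^sub>R \<psi> g)" for n g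
  have pos: "\<psi> g \<in> positive_cone" if "g \<in> carrier G" for g
    using \<psi> that by (auto simp: center_positive_def)
  have "h n \<in> C0 G" for n
    unfolding C0_def
  proof (intro CollectI allI impI)
    fix e :: real assume e: "e > 0"
    \<comment> \<open>Beyond this spectral length, \<open>exp (- t n * spectral_length \<psi> g)\<close> is below \<open>e\<close>.\<close>
    define R where "R = max 0 (- ln e / t n)"
    define F where "F = {g \<in> carrier G. spectral_length \<psi> g \<le> R}"
    have "norm (h n g) < e" if "g \<in> carrier G - F" for g
    proof -
      have g: "g \<in> carrier G" "spectral_length \<psi> g > R" using that by (auto simp: F_def)
      then have "- ln e / t n < spectral_length \<psi> g" by (simp add: R_def)
      then have "- t n * spectral_length \<psi> g < ln e" using t[of n] by (simp add: field_simps)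
      then have "exp (- t n * spectral_length \<psi> g) < e" using e by (metis exp_less_mono exp_ln)
      then show ?thesis
        using norm_exp_minus_le[where \<psi>=\<psi> and g=g and t="t n"] pos[OF g(1)] t[of n]
        unfolding h_def by linarith
    qed
    moreover have "finite F" using proper by (simp add: F_def R_def spectrally_proper_def)
    ultimately show "\<exists>F. finite F \<and> F \<subseteq> carrier G \<and> (\<forall>g\<in>carrier G - F. norm (h n g) < e)"
      by (intro exI[of _ F]) (auto simp: F_def)
  qed
  moreover have "positive_definite G \<alpha> (h n)" for n
    unfolding h_def[abs_def] by (rule positive_definite_exp[OF neg nor \<psi>]) (simp add: t less_imp_le)
  moreover have "h n \<in> carrier G \<rightarrow> algebra_center" for n
    using \<psi> unfolding h_def by (auto simp: center_positive_def intro!: center_exp simp flip: scaleR_minus_left intro: center_scaleR)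
  moreover have "h n \<one> = 1" for n using nor by (simp add: h_def normalized_def)
  moreover have "(\<lambda>n. norm (h n g - 1)) \<longlonglongrightarrow> 0" for g
  proof (rule tendsto_sandwich[where f="\<lambda>_. 0" and h="\<lambda>n. exp (t n * norm (\<psi> g)) - 1"])
    show "\<forall>\<^sub>F n in sequentially. norm (h n g - 1) \<le> exp (t n * norm (\<psi> g)) - 1"
      using norm_exp_minus_one[of "- t _ *\<^sub>R \<psi> g"] t by (intro always_eventually allI) (simp add: h_def less_imp_le abs_of_pos)
    have "(\<lambda>n. exp (t n * norm (\<psi> g)) - 1) \<longlonglongrightarrow> exp (0 * norm (\<psi> g)) - 1"
      unfolding t_def by (intro tendsto_intros LIMSEQ_inverse_real_of_nat)
    then show "(\<lambda>n. exp (t n * norm (\<psi> g)) - 1) \<longlonglongrightarrow> 0" by simp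
  qed simp_all
  ultimately show ?thesis unfolding haagerup_property_def by blast
qed

section \<open>From positive definite to negative definite functions\<close>

lemma positive_definite_hermitian:
  assumes "positive_definite G \<alpha> \<phi>" "g \<in> carrier G"
  shows "\<alpha> g (\<phi> (inv g)) = star (\<phi> g)"
proof -
  define x where "x i = (if i = 0 then \<one> else g)" for i :: nat
  have "positive_form 2 (kernel \<phi> x)"
    using assms by (auto simp: positive_definite_iff x_def)
  then have "star (kernel \<phi> x 0 1) = kernel \<phi> x 1 0" by (auto simp: coercive_def hermitian_def)
  then show ?thesis using assms(2) by (simp add: x_def action_one)
qed

text \<open>
  \<open>1 - Re \<phi>\<close>, where the real part of an element is its self-adjoint part.
\<close>
definition defect :: "('g \<Rightarrow> 'a) \<Rightarrow> 'g \<Rightarrow> 'a" where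
  "defect \<phi> g = 1 - (1/2) *\<^sub>R (\<phi> g + star (\<phi> g))"

text \<open>
  Twice the defect is the positive form of \<open>\<phi>\<close> at the points \<open>\<one>, g\<close> and the
  vector \<open>(1, -1)\<close>.
\<close>
lemma defect_positive:
  assumes \<phi>: "positive_definite G \<alpha> \<phi>" "\<phi> \<one> = 1" and g: "g \<in> carrier G"
  shows "defect \<phi> g \<in> positive_cone"
proof -
  define x where "x i = (if i = 0 then \<one> else g)" for i :: nat
  define b :: "nat \<Rightarrow> 'a" where "b i = (if i = 0 then 1 else - 1)" for i
  have "positive_form 2 (kernel \<phi> x)"
    using \<phi> g by (auto simp: positive_definite_iff x_def)
  then have "form 2 (kernel \<phi> x) b \<in> positive_cone" by (simp add: positive_form_iff)
  moreover have "form 2 (kernel \<phi> x) b = 2 *\<^sub>R defect \<phi> g"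
    using g positive_definite_hermitian[OF \<phi>(1) g]
    by (simp add: form_def x_def b_def numeral_2_eq_2 action_one \<phi>(2) action_simps defect_def
        scaleR_diff_right scaleR_2)
  ultimately have "2 *\<^sub>R defect \<phi> g \<in> positive_cone" by simp
  from positive_cone_scaleR[OF this, of "1/2"] show ?thesis by simp
qed

lemma defect_center: "\<phi> g \<in> algebra_center \<Longrightarrow> defect \<phi> g \<in> algebra_center"
  unfolding defect_def by (intro center_diff center_1 center_scaleR center_add center_star)

text \<open>
  On vectors with sum zero the constant \<open>1\<close> contributes nothing, and what remains is minus the form
  of the real part of \<open>\<phi>\<close>. Its kernel averages the kernel of \<open>\<phi>\<close> and the
  transposed kernel; this is where the values of \<open>\<phi>\<close> have to be central.
\<close>
lemma defect_negative_definite: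
  assumes \<phi>: "positive_definite G \<alpha> \<phi>" and cen: "\<phi> \<in> carrier G \<rightarrow> algebra_center"
  shows "negative_definite G \<alpha> (defect \<phi>)"
  unfolding negative_definite_iff
proof (intro conjI ballI allI impI)
  fix g assume g: "g \<in> carrier G"
  show "\<alpha> g (defect \<phi> (inv g)) = star (defect \<phi> g)"
    using positive_definite_hermitian[OF \<phi> g]
    by (simp add: defect_def action_simps[OF g] star_diff star_scaleR star_add star_star add.commute)
next
  fix n and g :: "nat \<Rightarrow> 'g" and b :: "nat \<Rightarrow> 'a"
  assume g: "\<forall>i<n. g i \<in> carrier G" and b: "(\<Sum>i<n. b i) = 0"
  have pf: "positive_form n (kernel \<phi> g)" using \<phi> g by (simp add: positive_definite_iff)
  then have pt: "positive_form n (\<lambda>i j. kernel \<phi> g j i)"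
    by (rule positive_form_transpose) (use g in \<open>auto intro: kernel_center[OF cen]\<close>)
  have "positive_form n (\<lambda>i j. (1/2) *\<^sub>R (kernel \<phi> g i j + kernel \<phi> g j i))"
    by (rule positive_form_scaleR[OF positive_form_add[OF pf pt]]) simp
  then have P: "form n (\<lambda>i j. (1/2) *\<^sub>R (kernel \<phi> g i j + kernel \<phi> g j i)) b \<in> positive_cone"
    by (simp add: positive_form_iff)
  have "kernel (defect \<phi>) g i j = 1 - (1/2) *\<^sub>R (kernel \<phi> g i j + kernel \<phi> g j i)" if "i < n" "j < n" for i j
    using that g pf by (simp add: defect_def action_simps coercive_def hermitian_def flip: action_simps(4))
  then have "form n (kernel (defect \<phi>) g) b
      = form n (\<lambda>i j. 1 - (1/2) *\<^sub>R (kernel \<phi> g i j + kernel \<phi> g j i)) b"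
    by (intro form_cong) auto
  also have "\<dots> = (\<Sum>i<n. star (b i) * (\<Sum>j<n. b j)) - form n (\<lambda>i j. (1/2) *\<^sub>R (kernel \<phi> g i j + kernel \<phi> g j i)) b"
    unfolding form_def sum_distrib_left
    by (simp add: left_diff_distrib right_diff_distrib sum_subtractf)
  finally show "- form n (kernel (defect \<phi>) g) b \<in> positive_cone" using P by (simp add: b)
qed

lemma defect_lower_bound:
  assumes "norm (\<phi> g) \<le> 1/2"
  shows "defect \<phi> g - of_real (1/2) \<in> positive_cone"
proof -
  let ?r = "(1/2) *\<^sub>R (\<phi> g + star (\<phi> g))"
  have "norm ?r \<le> 1/2" using assms norm_triangle_ineq[of "\<phi> g" "star (\<phi> g)"] by simp
  moreover have "star ?r = ?r" by (simp add: star_scaleR star_add star_star add.commute)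
  ultimately have "of_real (1/2) - ?r \<in> positive_cone" by (intro self_adjoint_le_norm)
  moreover have "defect \<phi> g - of_real (1/2) = of_real (1/2) - ?r"
    using scaleR_half_double[of "1::'a"] by (simp add: defect_def of_real_def algebra_simps flip: scaleR_add_left)
  ultimately show ?thesis by simp
qed

lemma norm_defect: "norm (defect \<phi> g) \<le> norm (\<phi> g - 1)"
proof -
  have "defect \<phi> g = - ((1/2) *\<^sub>R ((\<phi> g - 1) + star (\<phi> g - 1)))"
    using scaleR_half_double[of "1::'a"]
    by (simp add: defect_def star_diff algebra_simps flip: scaleR_add_left)
  then show ?thesis
    using norm_triangle_ineq[of "\<phi> g - 1" "star (\<phi> g - 1)"] by simp
qed

lemma negative_definite_suminf:
  assumes f: "\<And>k. negative_definite G \<alpha> (f k)" and c: "\<And>k. c k \<ge> (0::real)"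
    and s: "\<And>g. g \<in> carrier G \<Longrightarrow> (\<lambda>k. c k *\<^sub>R f k g) sums \<psi> g"
  shows "negative_definite G \<alpha> \<psi>"
  unfolding negative_definite_iff
proof (intro conjI ballI allI impI)
  fix g assume g: "g \<in> carrier G"
  have "(\<lambda>k. \<alpha> g (c k *\<^sub>R f k (inv g))) sums \<alpha> g (\<psi> (inv g))"
    by (rule bounded_linear.sums[OF star_automorphism_bounded_linear[OF action_automorphism[OF g]]
          s[OF inv_closed[OF g]]])
  moreover have "\<alpha> g (c k *\<^sub>R f k (inv g)) = star (c k *\<^sub>R f k g)" for k
    using f[of k] g by (simp add: negative_definite_iff action_simps star_scaleR)
  moreover have "(\<lambda>k. star (c k *\<^sub>R f k g)) sums star (\<psi> g)"
    by (rule bounded_linear.sums[OF bounded_linear_star s[OF g]])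
  ultimately show "\<alpha> g (\<psi> (inv g)) = star (\<psi> g)" using sums_unique2 by simp
next
  fix n and g :: "nat \<Rightarrow> 'g" and b :: "nat \<Rightarrow> 'a"
  assume g: "\<forall>i<n. g i \<in> carrier G" and b: "(\<Sum>i<n. b i) = 0"
  have "(\<lambda>k. form n (kernel (\<lambda>x. c k *\<^sub>R f k x) g) b) sums form n (kernel \<psi> g) b"
    unfolding form_def
  proof ((rule sums_sum)+, rule sums_mult2, rule sums_mult)
    fix i j assume "i \<in> {..<n}" "j \<in> {..<n}"
    then have gi: "g i \<in> carrier G" and gj: "g j \<in> carrier G" using g by auto
    show "(\<lambda>k. \<alpha> (g i) (c k *\<^sub>R f k (inv g i \<otimes> g j))) sums \<alpha> (g i) (\<psi> (inv g i \<otimes> g j))"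
      by (rule bounded_linear.sums[OF star_automorphism_bounded_linear[OF action_automorphism[OF gi]]
            s[OF m_closed[OF inv_closed[OF gi] gj]]])
  qed
  then have L: "(\<lambda>m. - (\<Sum>k<m. form n (kernel (\<lambda>x. c k *\<^sub>R f k x) g) b)) \<longlonglongrightarrow> - form n (kernel \<psi> g) b"
    unfolding sums_def by (rule tendsto_minus)
  have "form n (kernel (\<lambda>x. c k *\<^sub>R f k x) g) b = c k *\<^sub>R form n (kernel (f k) g) b" for k
    unfolding form_def scaleR_sum_right using g by (intro sum.cong refl) (simp add: action_simps)
  then have "- (\<Sum>k<m. form n (kernel (\<lambda>x. c k *\<^sub>R f k x) g) b) = (\<Sum>k<m. c k *\<^sub>R (- form n (kernel (f k) g) b))" for m
    by (simp add: sum_negf)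
  moreover have "(\<Sum>k<m. c k *\<^sub>R (- form n (kernel (f k) g) b)) \<in> positive_cone" for m
    using f g b c by (intro positive_cone_sum positive_cone_scaleR) (auto simp: negative_definite_iff)
  ultimately show "- form n (kernel \<psi> g) b \<in> positive_cone"
    by (intro positive_cone_limit[OF _ L]) simp
qed

text \<open>
  Take \<open>\<psi> = (\<Sum>k. 2 ^ k * (1 - Re (h (N k))))\<close>, where \<open>N k\<close> is so large that
  \<open>h (N k)\<close> is within \<open>4 ^ (- k)\<close> of \<open>1\<close> at the first
  \<open>k + 1\<close> group elements. At each point the series is eventually dominated by
  \<open>2 ^ (- k)\<close>. It is spectrally proper because the single term
  \<open>2 ^ k * (1 - Re (h (N k)))\<close> is at least \<open>2 ^ k / 2\<close> off a finite set and the other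
  terms are positive.
\<close>
lemma negative_definite_of_haagerup:
  assumes count: "countable (carrier G)" and H: "haagerup_property G \<alpha>"
  shows "\<exists>\<psi>. \<psi> \<in> carrier G \<rightarrow> center_positive \<and> negative_definite G \<alpha> \<psi> \<and>
    normalized G \<psi> \<and> spectrally_proper G \<psi>"
proof -
  obtain h :: "nat \<Rightarrow> 'g \<Rightarrow> 'a" where h: "\<And>n. positive_definite G \<alpha> (h n)"
    "\<And>n. h n \<in> carrier G \<rightarrow> algebra_center" "\<And>n. h n \<one> = 1" "\<And>n. h n \<in> C0 G"
    and lim: "\<And>g. g \<in> carrier G \<Longrightarrow> (\<lambda>n. norm (h n g - 1)) \<longlonglongrightarrow> 0"
    using H unfolding haagerup_property_def by blast
  define enum where "enum = from_nat_into (carrier G)"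
  have enum: "enum m \<in> carrier G" for m
    unfolding enum_def by (rule from_nat_into) (use one_closed in blast)
  have "\<exists>N. \<forall>m\<le>k. norm (h N (enum m) - 1) \<le> (1/4) ^ k" for k
  proof -
    have "\<forall>\<^sub>F N in sequentially. \<forall>m\<in>{..k}. norm (h N (enum m) - 1) < (1/4) ^ k"
      using order_tendstoD(2)[OF lim[OF enum]] by (intro eventually_ball_finite) auto
    then show ?thesis by (auto simp: eventually_sequentially intro: less_imp_le)
  qed
  then obtain N where N: "\<And>k m. m \<le> k \<Longrightarrow> norm (h (N k) (enum m) - 1) \<le> (1/4) ^ k" by metis
  define f where "f k = defect (h (N k))" for k
  define \<psi> where "\<psi> g = (\<Sum>k. (2 ^ k :: real) *\<^sub>R f k g)" for g
  have sums: "(\<lambda>k. (2 ^ k :: real) *\<^sub>R f k g) sums \<psi> g" if g: "g \<in> carrier G" for g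
    unfolding \<psi>_def
  proof (rule summable_sums, rule summable_comparison_test)
    obtain m where m: "enum m = g"
      using from_nat_into_surj[OF count g] by (auto simp: enum_def)
    show "\<exists>K. \<forall>k\<ge>K. norm ((2 ^ k :: real) *\<^sub>R f k g) \<le> (1/2) ^ k"
    proof (intro exI allI impI)
      fix k assume "m \<le> k"
      then have "norm (f k g) \<le> (1/4) ^ k"
        using N[of m k] norm_defect[of "h (N k)" g] by (simp add: f_def m)
      then have "2 ^ k * norm (f k g) \<le> 2 ^ k * (1/4) ^ k" by (intro mult_left_mono) auto
      also have "\<dots> = (1/2) ^ k" by (simp flip: power_mult_distrib)
      finally show "norm ((2 ^ k :: real) *\<^sub>R f k g) \<le> (1/2) ^ k" by simp
    qed
    show "summable (\<lambda>k. (1/2 :: real) ^ k)" by (simp add: summable_geometric)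
  qed
  have fpos: "f k g \<in> positive_cone" if "g \<in> carrier G" for k g
    unfolding f_def by (rule defect_positive[OF h(1) h(3) that])
  have fcen: "f k g \<in> algebra_center" if "g \<in> carrier G" for k g
    unfolding f_def using h(2) that by (intro defect_center) blast
  have tail: "\<psi> g - (2 ^ k :: real) *\<^sub>R f k g \<in> positive_cone" if g: "g \<in> carrier G" for k g
  proof (rule positive_cone_limit)
    have "(\<lambda>m. (\<Sum>i<m. (2 ^ i :: real) *\<^sub>R f i g) - (2 ^ k :: real) *\<^sub>R f k g)
        \<longlonglongrightarrow> \<psi> g - (2 ^ k :: real) *\<^sub>R f k g"
      using sums[OF g] unfolding sums_def by (intro tendsto_intros)
    from LIMSEQ_ignore_initial_segment[OF this, of "Suc k"]
    show "(\<lambda>m. (\<Sum>i<m + Suc k. (2 ^ i :: real) *\<^sub>R f i g) - (2 ^ k :: real) *\<^sub>R f k g)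
        \<longlonglongrightarrow> \<psi> g - (2 ^ k :: real) *\<^sub>R f k g" .
    fix m
    have "(\<Sum>i<m + Suc k. (2 ^ i :: real) *\<^sub>R f i g) - (2 ^ k :: real) *\<^sub>R f k g
        = (\<Sum>i\<in>{..<m + Suc k} - {k}. (2 ^ i :: real) *\<^sub>R f i g)"
      by (subst sum_diff1) auto
    also have "\<dots> \<in> positive_cone" by (intro positive_cone_sum positive_cone_scaleR fpos g) simp
    finally show "(\<Sum>i<m + Suc k. (2 ^ i :: real) *\<^sub>R f i g) - (2 ^ k :: real) *\<^sub>R f k g \<in> positive_cone" .
  qed
  have pos: "\<psi> g \<in> positive_cone" if g: "g \<in> carrier G" for g
    using positive_cone_add[OF tail[OF g, of 0] positive_cone_scaleR[OF fpos[OF g, of 0], of 1]] by simp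
  have cen: "\<psi> g \<in> algebra_center" if g: "g \<in> carrier G" for g
    by (rule center_limit[OF _ sums[OF g, unfolded sums_def]]) (intro center_sum center_scaleR fcen g)
  have "negative_definite G \<alpha> \<psi>"
  proof (rule negative_definite_suminf[where f=f and c="\<lambda>k. 2 ^ k"])
    show "negative_definite G \<alpha> (f k)" for k
      unfolding f_def by (rule defect_negative_definite[OF h(1) h(2)])
  qed (simp_all add: sums)
  moreover have "normalized G \<psi>"
    by (simp add: normalized_def \<psi>_def f_def defect_def h(3) scaleR_half_double del: one_add_one)
  moreover have "spectrally_proper G \<psi>"
    unfolding spectrally_proper_def
  proof (intro conjI allI impI)
    show "\<psi> \<in> carrier G \<rightarrow> positive_cone" using pos by blast
    fix R :: real
    obtain k where k: "2 * R < 2 ^ k" using real_arch_pow[of 2 "2 * R"] by auto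
    have "\<forall>\<epsilon>>0. \<exists>F. finite F \<and> F \<subseteq> carrier G \<and> (\<forall>g\<in>carrier G - F. norm (h (N k) g) < \<epsilon>)"
      using h(4)[of "N k"] by (simp add: C0_def)
    from this[rule_format, of "1/2"] obtain F
      where F: "finite F" "\<And>g. g \<in> carrier G - F \<Longrightarrow> norm (h (N k) g) < 1/2" by auto
    have "spectral_length \<psi> g > R" if g: "g \<in> carrier G - F" for g
    proof -
      have "(2 ^ k :: real) *\<^sub>R (f k g - of_real (1/2)) \<in> positive_cone"
        unfolding f_def using F(2)[OF g] by (intro positive_cone_scaleR defect_lower_bound) auto
      moreover have "\<psi> g - (2 ^ k :: real) *\<^sub>R f k g \<in> positive_cone" using g by (intro tail) auto
      ultimately have "(2 ^ k :: real) *\<^sub>R (f k g - of_real (1/2)) + (\<psi> g - (2 ^ k :: real) *\<^sub>R f k g) \<in> positive_cone"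
        by (rule positive_cone_add)
      also have "(2 ^ k :: real) *\<^sub>R (f k g - of_real (1/2)) + (\<psi> g - (2 ^ k :: real) *\<^sub>R f k g)
          = \<psi> g - of_real (2 ^ k / 2)"
        by (simp add: scaleR_diff_right of_real_def)
      finally have "2 ^ k / 2 \<le> spectral_length \<psi> g" by (rule spectral_length_ge[where \<psi>=\<psi> and g=g])
      with k show ?thesis by simp
    qed
    then have "{g \<in> carrier G. spectral_length \<psi> g \<le> R} \<subseteq> F" by force
    then show "finite {g \<in> carrier G. spectral_length \<psi> g \<le> R}" using F(1) by (rule finite_subset)
  qed
  moreover have "\<psi> \<in> carrier G \<rightarrow> center_positive" using pos cen by (auto simp: center_positive_def)
  ultimately show ?thesis by blast
qed

end

theorem theorem3p24:
  fixes G :: "('g, 'm) monoid_scheme" (structure)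
    and \<alpha> :: "'g \<Rightarrow> 'a::unital_cstar_algebra \<Rightarrow> 'a"
  assumes "group G"
    and "countable (carrier G)"
    and "\<alpha> \<in> hom G Aut"
  shows "haagerup_property G \<alpha> \<longleftrightarrow>
    (\<exists>\<psi> :: 'g \<Rightarrow> 'a.
       \<psi> \<in> carrier G \<rightarrow> center_positive \<and>
       negative_definite G \<alpha> \<psi> \<and>
       normalized G \<psi> \<and>
       spectrally_proper G \<psi>)"
proof -
  interpret cstar_action G \<alpha>
    using assms by (simp add: cstar_action_def cstar_action_axioms_def)
  show ?thesis
    using negative_definite_of_haagerup[OF assms(2)] haagerup_of_negative_definite by blast
qed

end
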